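(* Let $\mathrm{Ty}^{\mathrm{Disc}}(\Gamma)$ be the set of discrete types over $\Gamma$ in the presheaf CwF over $\mathrm{BPCube}$. Keeping contexts, substitutions, terms and context extension of the presheaf CwF $\widehat{\mathrm{BPCube}}$ but taking $\mathrm{Ty}^{\mathrm{Disc}}$ as the types yields a well-defined CwF $\widehat{\mathrm{BPCube}}_{\mathrm{Disc}}$, and this CwF supports dependent products, dependent sums and identity types.
   Context: $\mathrm{BPCube}$: objects pairs $W=(W_B,W_P)$ of disjoint finite sets of names (bridge and path variables); face maps $\varphi:V\to W$ assign to bridge variables of $W$ values in $\{0,1\}\cup V_B$ and to path variables values in $\{0,1\}\cup V_B\cup V_P$; composition by substitution. Presheaf CwF: contexts presheaves $\Gamma$; types give sets $T[\gamma]$ ($\gamma\in\Gamma(W)$) with functorial restrictions $t\langle\varphi\rangle\in T[\gamma\varphi]$, substitution $T[\sigma][\delta]=T[\sigma\delta]$; terms are natural families $t[\gamma]\in T[\gamma]$; $(\Gamma.T)(W)=\{(\gamma,t)\}$. With $(W,i{:}\mathbb P)$ the extension by a fresh path variable and $(\setminus i):(W,i{:}\mathbb P)\to W$ the weakening face map, $\gamma\in\Gamma(W,i{:}\mathbb P)$ (resp. $t\in T[\gamma]$) is degenerate in $i$ if it equals $\gamma'(\setminus i)$ (resp. $t'\langle\setminus i\rangle$). A type $T$ is discrete if every $t\in T[\gamma]$ is degenerate in each path variable in which $\gamma$ is degenerate. A CwF supports dependent sums (products) if for types $\Gamma\vdash A$, $\Gamma.A\vdash B$ there is a type $\Sigma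 A B$ ($\Pi AB$) over $\Gamma$ with pairing and projections (resp. $\lambda$ and application) that are mutually inverse, all commuting with substitution; it supports identity types if for $\Gamma\vdash a,b:A$ there is a type $a=_Ab$ with $\mathrm{refl}$ and an eliminator $\mathrm{J}$ (for motives $C$ over $\Gamma, y{:}A, w{:}a=_Ay$) satisfying $\mathrm{J}(a,a,C,\mathrm{refl}\,a,c)=c$, all commuting with substitution. In the presheaf model these are the standard presheaf constructions, e.g. $(\Sigma AB)[\gamma]=\{(a,b):a\in A[\gamma],b\in B[(\gamma,a)]\}$, $(\Pi AB)[\gamma]$ = terms of $B[\gamma{+}]$ over $yW.A[\gamma]$, $(a=_Ab)[\gamma]=\{\star\}$ if $a[\gamma]=b[\gamma]$ and $\emptyset$ otherwise. *)

theory Defs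
  imports Main "HOL-Library.FuncSet"
begin

section \<open>The category BPCube\<close>

text \<open>Names are natural numbers, so that there is always a fresh one.\<close>

typedef bpcube = "{(B :: nat set, P :: nat set). finite B \<and> finite P \<and> B \<inter> P = {}}"
  by (rule exI[of _ "({}, {})"]) simp

definition bridge_vars :: "bpcube \<Rightarrow> nat set" where
  "bridge_vars W = fst (Rep_bpcube W)"

definition path_vars :: "bpcube \<Rightarrow> nat set" where
  "path_vars W = snd (Rep_bpcube W)"

definition vars :: "bpcube \<Rightarrow> nat set" where
  "vars W = bridge_vars W \<union> path_vars W"

datatype face_value = Zero | One | Var nat

text \<open>A face map \<open>V \<rightarrow> W\<close> is stored together with its domain and codomain; its value is
  fixed to \<open>undefined\<close> outside the variables of \<open>W\<close>, so that equality of face maps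
  is equality in the type.\<close>

typedef face = "{(V, f, W).
    (\<forall>i\<in>bridge_vars W. f i \<in> {Zero, One} \<union> Var ` bridge_vars V) \<and>
    (\<forall>i\<in>path_vars W. f i \<in> {Zero, One} \<union> Var ` (bridge_vars V \<union> path_vars V)) \<and>
    f \<in> extensional (vars W)}"
proof -
  define W where "W = Abs_bpcube ({}, {})"
  have "Rep_bpcube W = ({}, {})"
    unfolding W_def by (rule Abs_bpcube_inverse) simp
  then show ?thesis
    by (intro exI[of _ "(W, \<lambda>_. undefined, W)"])
       (simp add: bridge_vars_def path_vars_def vars_def)
qed

definition face_dom :: "face \<Rightarrow> bpcube" where
  "face_dom \<phi> = fst (Rep_face \<phi>)"

definition face_map :: "face \<Rightarrow> nat \<Rightarrow> face_value" where
  "face_map \<phi> = fst (snd (Rep_face \<phi>))"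

definition face_cod :: "face \<Rightarrow> bpcube" where
  "face_cod \<phi> = snd (snd (Rep_face \<phi>))"

definition face_id :: "bpcube \<Rightarrow> face" where
  "face_id W = Abs_face (W, restrict Var (vars W), W)"

fun face_subst :: "(nat \<Rightarrow> face_value) \<Rightarrow> face_value \<Rightarrow> face_value" where
  "face_subst g Zero = Zero"
| "face_subst g One = One"
| "face_subst g (Var j) = g j"

text \<open>The composite \<open>\<phi>\<psi>\<close> is meaningful only if \<open>face_dom \<phi> = face_cod \<psi>\<close>.\<close>

definition face_comp :: "face \<Rightarrow> face \<Rightarrow> face" where
  "face_comp \<phi> \<psi> = Abs_face
     (face_dom \<psi>,
      restrict (\<lambda>i. face_subst (face_map \<psi>) (face_map \<phi> i)) (vars (face_cod \<phi>)),
      face_cod \<phi>)"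

text \<open>The extension \<open>(W, i : \<P>)\<close> and the weakening \<open>(W, i : \<P>) \<rightarrow> W\<close>; both are
  meaningful only if \<open>i \<notin> vars W\<close>.\<close>

definition path_ext :: "bpcube \<Rightarrow> nat \<Rightarrow> bpcube" where
  "path_ext W i = Abs_bpcube (bridge_vars W, insert i (path_vars W))"

definition weaken :: "bpcube \<Rightarrow> nat \<Rightarrow> face" where
  "weaken W i = Abs_face (path_ext W i, restrict Var (vars W), W)"


section \<open>The presheaf CwF over BPCube\<close>

text \<open>The sets \<open>\<Gamma>(W)\<close> and \<open>T[\<gamma>]\<close> are subsets of arbitrary HOL types, which are type
  parameters of contexts and types: no single HOL type can be shown to contain representatives
  of all sets arising by iterated dependent products.\<close>

text \<open>Functions with a restricted domain (restriction maps, substitutions, terms) have the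
  value \<open>undefined\<close> outside this domain, and fibres over non-elements are empty. The
  equations of a CwF thus hold as equations between HOL terms. The operations below take the
  context over which their result lives as an argument in order to perform this truncation.\<close>

record 'g psh =
  el :: "bpcube \<Rightarrow> 'g set"
  res :: "face \<Rightarrow> 'g \<Rightarrow> 'g"

definition is_psh :: "'g psh \<Rightarrow> bool" where
  "is_psh \<Gamma> \<longleftrightarrow>
     (\<forall>\<phi>. \<forall>\<gamma>\<in>el \<Gamma> (face_cod \<phi>). res \<Gamma> \<phi> \<gamma> \<in> el \<Gamma> (face_dom \<phi>)) \<and>
     (\<forall>W. \<forall>\<gamma>\<in>el \<Gamma> W. res \<Gamma> (face_id W) \<gamma> = \<gamma>) \<and>
     (\<forall>\<phi> \<psi>. face_dom \<phi> = face_cod \<psi> \<longrightarrow>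
        (\<forall>\<gamma>\<in>el \<Gamma> (face_cod \<phi>). res \<Gamma> (face_comp \<phi> \<psi>) \<gamma> = res \<Gamma> \<psi> (res \<Gamma> \<phi> \<gamma>))) \<and>
     (\<forall>\<phi>. res \<Gamma> \<phi> \<in> extensional (el \<Gamma> (face_cod \<phi>)))"

type_synonym ('d, 'g) sub = "bpcube \<Rightarrow> 'd \<Rightarrow> 'g"

definition is_sub :: "'d psh \<Rightarrow> 'g psh \<Rightarrow> ('d, 'g) sub \<Rightarrow> bool" where
  "is_sub \<Delta> \<Gamma> \<sigma> \<longleftrightarrow>
     (\<forall>W. \<sigma> W \<in> el \<Delta> W \<rightarrow>\<^sub>E el \<Gamma> W) \<and>
     (\<forall>\<phi>. \<forall>\<delta>\<in>el \<Delta> (face_cod \<phi>).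
        \<sigma> (face_dom \<phi>) (res \<Delta> \<phi> \<delta>) = res \<Gamma> \<phi> (\<sigma> (face_cod \<phi>) \<delta>))"

definition sub_id :: "'g psh \<Rightarrow> ('g, 'g) sub" where
  "sub_id \<Gamma> W = restrict (\<lambda>\<gamma>. \<gamma>) (el \<Gamma> W)"

definition sub_comp :: "'e psh \<Rightarrow> ('d, 'g) sub \<Rightarrow> ('e, 'd) sub \<Rightarrow> ('e, 'g) sub" where
  "sub_comp \<Theta> \<sigma> \<tau> W = restrict (\<lambda>\<theta>. \<sigma> W (\<tau> W \<theta>)) (el \<Theta> W)"

definition empty_ctx :: "unit psh" where
  "empty_ctx = \<lparr>el = (\<lambda>W. {()}), res = (\<lambda>\<phi> _. ())\<rparr>"

text \<open>\<open>fib T W \<gamma>\<close> is \<open>T[\<gamma>]\<close> for \<open>\<gamma> \<in> \<Gamma>(W)\<close>, and \<open>fres T \<phi> \<gamma> t\<close> is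
  \<open>t\<langle>\<phi>\<rangle>\<close> for \<open>t \<in> T[\<gamma>]\<close>.\<close>

record ('g, 'a) ty =
  fib :: "bpcube \<Rightarrow> 'g \<Rightarrow> 'a set"
  fres :: "face \<Rightarrow> 'g \<Rightarrow> 'a \<Rightarrow> 'a"

definition is_ty :: "'g psh \<Rightarrow> ('g, 'a) ty \<Rightarrow> bool" where
  "is_ty \<Gamma> T \<longleftrightarrow>
     (\<forall>\<phi>. \<forall>\<gamma>\<in>el \<Gamma> (face_cod \<phi>). \<forall>t\<in>fib T (face_cod \<phi>) \<gamma>.
        fres T \<phi> \<gamma> t \<in> fib T (face_dom \<phi>) (res \<Gamma> \<phi> \<gamma>)) \<and>
     (\<forall>W. \<forall>\<gamma>\<in>el \<Gamma> W. \<forall>t\<in>fib T W \<gamma>. fres T (face_id W) \<gamma> t = t) \<and>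
     (\<forall>\<phi> \<psi>. face_dom \<phi> = face_cod \<psi> \<longrightarrow>
        (\<forall>\<gamma>\<in>el \<Gamma> (face_cod \<phi>). \<forall>t\<in>fib T (face_cod \<phi>) \<gamma>.
           fres T (face_comp \<phi> \<psi>) \<gamma> t = fres T \<psi> (res \<Gamma> \<phi> \<gamma>) (fres T \<phi> \<gamma> t))) \<and>
     (\<forall>W \<gamma>. \<gamma> \<notin> el \<Gamma> W \<longrightarrow> fib T W \<gamma> = {}) \<and>
     (\<forall>\<phi> \<gamma>. fres T \<phi> \<gamma> \<in> extensional (fib T (face_cod \<phi>) \<gamma>))"

definition ty_sub :: "'d psh \<Rightarrow> ('d, 'g) sub \<Rightarrow> ('g, 'a) ty \<Rightarrow> ('d, 'a) ty" where
  "ty_sub \<Delta> \<sigma> T =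
     \<lparr>fib = (\<lambda>W \<delta>. if \<delta> \<in> el \<Delta> W then fib T W (\<sigma> W \<delta>) else {}),
      fres = (\<lambda>\<phi> \<delta>. if \<delta> \<in> el \<Delta> (face_cod \<phi>) then fres T \<phi> (\<sigma> (face_cod \<phi>) \<delta>)
                     else (\<lambda>_. undefined))\<rparr>"

type_synonym ('g, 'a) tm = "bpcube \<Rightarrow> 'g \<Rightarrow> 'a"

definition is_tm :: "'g psh \<Rightarrow> ('g, 'a) ty \<Rightarrow> ('g, 'a) tm \<Rightarrow> bool" where
  "is_tm \<Gamma> T t \<longleftrightarrow>
     (\<forall>W. t W \<in> (\<Pi>\<^sub>E \<gamma>\<in>el \<Gamma> W. fib T W \<gamma>)) \<and>
     (\<forall>\<phi>. \<forall>\<gamma>\<in>el \<Gamma> (face_cod \<phi>).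
        t (face_dom \<phi>) (res \<Gamma> \<phi> \<gamma>) = fres T \<phi> \<gamma> (t (face_cod \<phi>) \<gamma>))"

definition tm_sub :: "'d psh \<Rightarrow> ('d, 'g) sub \<Rightarrow> ('g, 'a) tm \<Rightarrow> ('d, 'a) tm" where
  "tm_sub \<Delta> \<sigma> t W = restrict (\<lambda>\<delta>. t W (\<sigma> W \<delta>)) (el \<Delta> W)"

definition ctx_ext :: "'g psh \<Rightarrow> ('g, 'a) ty \<Rightarrow> ('g \<times> 'a) psh" where
  "ctx_ext \<Gamma> T =
     \<lparr>el = (\<lambda>W. {(\<gamma>, t). \<gamma> \<in> el \<Gamma> W \<and> t \<in> fib T W \<gamma>}),
      res = (\<lambda>\<phi>. restrict (\<lambda>(\<gamma>, t). (res \<Gamma> \<phi> \<gamma>, fres T \<phi> \<gamma> t))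
                  {(\<gamma>, t). \<gamma> \<in> el \<Gamma> (face_cod \<phi>) \<and> t \<in> fib T (face_cod \<phi>) \<gamma>})\<rparr>"

definition proj :: "'g psh \<Rightarrow> ('g, 'a) ty \<Rightarrow> ('g \<times> 'a, 'g) sub" where
  "proj \<Gamma> T W = restrict fst (el (ctx_ext \<Gamma> T) W)"

definition last_var :: "'g psh \<Rightarrow> ('g, 'a) ty \<Rightarrow> ('g \<times> 'a, 'a) tm" where
  "last_var \<Gamma> T W = restrict snd (el (ctx_ext \<Gamma> T) W)"

definition sub_ext :: "'d psh \<Rightarrow> ('d, 'g) sub \<Rightarrow> ('d, 'a) tm \<Rightarrow> ('d, 'g \<times> 'a) sub" where
  "sub_ext \<Delta> \<sigma> t W = restrict (\<lambda>\<delta>. (\<sigma> W \<delta>, t W \<delta>)) (el \<Delta> W)"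

text \<open>The substitution \<open>\<sigma>+ : \<Delta>.T[\<sigma>] \<rightarrow> \<Gamma>.T\<close>.\<close>

definition sub_lift ::
  "'d psh \<Rightarrow> ('d, 'g) sub \<Rightarrow> ('g, 'a) ty \<Rightarrow> ('d \<times> 'a, 'g \<times> 'a) sub" where
  "sub_lift \<Delta> \<sigma> T =
     (let \<Delta>T = ctx_ext \<Delta> (ty_sub \<Delta> \<sigma> T)
      in sub_ext \<Delta>T (sub_comp \<Delta>T \<sigma> (proj \<Delta> (ty_sub \<Delta> \<sigma> T)))
           (last_var \<Delta> (ty_sub \<Delta> \<sigma> T)))"

definition sub_inst :: "'g psh \<Rightarrow> ('g, 'a) tm \<Rightarrow> ('g, 'g \<times> 'a) sub" where
  "sub_inst \<Gamma> a = sub_ext \<Gamma> (sub_id \<Gamma>) a"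


section \<open>Discrete types\<close>

definition ctx_degenerate :: "'g psh \<Rightarrow> bpcube \<Rightarrow> nat \<Rightarrow> 'g \<Rightarrow> bool" where
  "ctx_degenerate \<Gamma> W i \<gamma> \<longleftrightarrow> (\<exists>\<gamma>'\<in>el \<Gamma> W. \<gamma> = res \<Gamma> (weaken W i) \<gamma>')"

definition ty_degenerate :: "'g psh \<Rightarrow> ('g, 'a) ty \<Rightarrow> bpcube \<Rightarrow> nat \<Rightarrow> 'g \<Rightarrow> 'a \<Rightarrow> bool" where
  "ty_degenerate \<Gamma> T W i \<gamma> t \<longleftrightarrow>
     (\<exists>\<gamma>'\<in>el \<Gamma> W. \<gamma> = res \<Gamma> (weaken W i) \<gamma>' \<and> (\<exists>t'\<in>fib T W \<gamma>'. t = fres T (weaken W i) \<gamma>' t'))"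

definition discrete :: "'g psh \<Rightarrow> ('g, 'a) ty \<Rightarrow> bool" where
  "discrete \<Gamma> T \<longleftrightarrow>
     (\<forall>W i. i \<notin> vars W \<longrightarrow>
        (\<forall>\<gamma>\<in>el \<Gamma> (path_ext W i). ctx_degenerate \<Gamma> W i \<gamma> \<longrightarrow>
           (\<forall>t\<in>fib T (path_ext W i) \<gamma>. ty_degenerate \<Gamma> T W i \<gamma> t)))"

definition disc_ty :: "'g psh \<Rightarrow> ('g, 'a) ty \<Rightarrow> bool" where
  "disc_ty \<Gamma> T \<longleftrightarrow> is_ty \<Gamma> T \<and> discrete \<Gamma> T"


section \<open>Dependent sums\<close>

definition Sigma_ty :: "'g psh \<Rightarrow> ('g, 'a) ty \<Rightarrow> ('g \<times> 'a, 'b) ty \<Rightarrow> ('g, 'a \<times> 'b) ty" where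
  "Sigma_ty \<Gamma> A B =
     \<lparr>fib = (\<lambda>W \<gamma>. {(a, b). a \<in> fib A W \<gamma> \<and> b \<in> fib B W (\<gamma>, a)}),
      fres = (\<lambda>\<phi> \<gamma>. restrict (\<lambda>(a, b). (fres A \<phi> \<gamma> a, fres B \<phi> (\<gamma>, a) b))
                {(a, b). a \<in> fib A (face_cod \<phi>) \<gamma> \<and> b \<in> fib B (face_cod \<phi>) (\<gamma>, a)})\<rparr>"

definition pair_tm :: "'g psh \<Rightarrow> ('g, 'a) tm \<Rightarrow> ('g, 'b) tm \<Rightarrow> ('g, 'a \<times> 'b) tm" where
  "pair_tm \<Gamma> a b W = restrict (\<lambda>\<gamma>. (a W \<gamma>, b W \<gamma>)) (el \<Gamma> W)"

definition fst_tm :: "'g psh \<Rightarrow> ('g, 'a \<times> 'b) tm \<Rightarrow> ('g, 'a) tm" where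
  "fst_tm \<Gamma> p W = restrict (\<lambda>\<gamma>. fst (p W \<gamma>)) (el \<Gamma> W)"

definition snd_tm :: "'g psh \<Rightarrow> ('g, 'a \<times> 'b) tm \<Rightarrow> ('g, 'b) tm" where
  "snd_tm \<Gamma> p W = restrict (\<lambda>\<gamma>. snd (p W \<gamma>)) (el \<Gamma> W)"


section \<open>Dependent products\<close>

definition yoneda :: "bpcube \<Rightarrow> face psh" where
  "yoneda W =
     \<lparr>el = (\<lambda>V. {\<phi>. face_dom \<phi> = V \<and> face_cod \<phi> = W}),
      res = (\<lambda>\<psi>. restrict (\<lambda>\<phi>. face_comp \<phi> \<psi>)
                  {\<phi>. face_dom \<phi> = face_cod \<psi> \<and> face_cod \<phi> = W})\<rparr>"

text \<open>An element \<open>\<gamma> \<in> \<Gamma>(W)\<close> as a substitution \<open>yW \<rightarrow> \<Gamma>\<close>.\<close>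

definition yoneda_sub :: "'g psh \<Rightarrow> bpcube \<Rightarrow> 'g \<Rightarrow> (face, 'g) sub" where
  "yoneda_sub \<Gamma> W \<gamma> V = restrict (\<lambda>\<phi>. res \<Gamma> \<phi> \<gamma>) (el (yoneda W) V)"

text \<open>The context \<open>yW.A[\<gamma>]\<close> and the substitution \<open>\<gamma>+ : yW.A[\<gamma>] \<rightarrow> \<Gamma>.A\<close>.\<close>

definition yoneda_ext :: "'g psh \<Rightarrow> ('g, 'a) ty \<Rightarrow> bpcube \<Rightarrow> 'g \<Rightarrow> (face \<times> 'a) psh" where
  "yoneda_ext \<Gamma> A W \<gamma> = ctx_ext (yoneda W) (ty_sub (yoneda W) (yoneda_sub \<Gamma> W \<gamma>) A)"

definition yoneda_lift ::
  "'g psh \<Rightarrow> ('g, 'a) ty \<Rightarrow> bpcube \<Rightarrow> 'g \<Rightarrow> (face \<times> 'a, 'g \<times> 'a) sub" where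
  "yoneda_lift \<Gamma> A W \<gamma> = sub_lift (yoneda W) (yoneda_sub \<Gamma> W \<gamma>) A"

text \<open>An element of the fibre of the product over \<open>\<gamma> \<in> \<Gamma>(W)\<close> is a term of \<open>B[\<gamma>+]\<close> over
  \<open>yW.A[\<gamma>]\<close>. It is restricted along \<open>\<phi> : V \<rightarrow> W\<close> by substitution with
  \<open>\<phi>+ : yV.A[\<gamma>\<phi>] \<rightarrow> yW.A[\<gamma>]\<close>, where \<open>\<phi>\<close> is regarded as a substitution \<open>yV \<rightarrow> yW\<close>
  and \<open>A[\<gamma>\<phi>]\<close> as \<open>A[\<gamma>][\<phi>]\<close>.\<close>

definition Pi_ty ::
  "'g psh \<Rightarrow> ('g, 'a) ty \<Rightarrow> ('g \<times> 'a, 'b) ty \<Rightarrow> ('g, (face \<times> 'a, 'b) tm) ty" where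
  "Pi_ty \<Gamma> A B =
     (let F = (\<lambda>W \<gamma>. if \<gamma> \<in> el \<Gamma> W
                 then {f. is_tm (yoneda_ext \<Gamma> A W \<gamma>)
                            (ty_sub (yoneda_ext \<Gamma> A W \<gamma>) (yoneda_lift \<Gamma> A W \<gamma>) B) f}
                 else {})
      in \<lparr>fib = F,
          fres = (\<lambda>\<phi> \<gamma>. restrict
             (\<lambda>f. tm_sub (yoneda_ext \<Gamma> A (face_dom \<phi>) (res \<Gamma> \<phi> \<gamma>))
                    (sub_lift (yoneda (face_dom \<phi>)) (yoneda_sub (yoneda (face_cod \<phi>)) (face_dom \<phi>) \<phi>)
                       (ty_sub (yoneda (face_cod \<phi>)) (yoneda_sub \<Gamma> (face_cod \<phi>) \<gamma>) A))
                    f)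
             (F (face_cod \<phi>) \<gamma>))\<rparr>)"

definition lam_tm ::
  "'g psh \<Rightarrow> ('g, 'a) ty \<Rightarrow> ('g \<times> 'a, 'b) tm \<Rightarrow> ('g, (face \<times> 'a, 'b) tm) tm" where
  "lam_tm \<Gamma> A b W =
     restrict (\<lambda>\<gamma>. tm_sub (yoneda_ext \<Gamma> A W \<gamma>) (yoneda_lift \<Gamma> A W \<gamma>) b) (el \<Gamma> W)"

text \<open>Application to the last variable of \<open>\<Gamma>.A\<close>; application of \<open>f\<close> to a term \<open>a\<close> of \<open>A\<close> is
  \<open>tm_sub \<Gamma> (sub_inst \<Gamma> a) (ap_tm \<Gamma> A f)\<close>.\<close>

definition ap_tm ::
  "'g psh \<Rightarrow> ('g, 'a) ty \<Rightarrow> ('g, (face \<times> 'a, 'b) tm) tm \<Rightarrow> ('g \<times> 'a, 'b) tm" where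
  "ap_tm \<Gamma> A f W = restrict (\<lambda>(\<gamma>, a). f W \<gamma> W (face_id W, a)) (el (ctx_ext \<Gamma> A) W)"


section \<open>Identity types\<close>

definition Id_ty ::
  "'g psh \<Rightarrow> ('g, 'a) ty \<Rightarrow> ('g, 'a) tm \<Rightarrow> ('g, 'a) tm \<Rightarrow> ('g, unit) ty" where
  "Id_ty \<Gamma> A a b =
     \<lparr>fib = (\<lambda>W \<gamma>. if \<gamma> \<in> el \<Gamma> W \<and> a W \<gamma> = b W \<gamma> then {()} else {}),
      fres = (\<lambda>\<phi> \<gamma> _. ())\<rparr>"

definition refl_tm :: "'g psh \<Rightarrow> ('g, 'a) tm \<Rightarrow> ('g, unit) tm" where
  "refl_tm \<Gamma> a = (\<lambda>W \<gamma>. ())"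

text \<open>The context \<open>\<Gamma>, y : A, w : a =\<^sub>A y\<close> of motives is \<open>\<Gamma>.A\<close> extended by
  \<open>Id_motive_ty \<Gamma> A a\<close>.\<close>

definition Id_motive_ty ::
  "'g psh \<Rightarrow> ('g, 'a) ty \<Rightarrow> ('g, 'a) tm \<Rightarrow> ('g \<times> 'a, unit) ty" where
  "Id_motive_ty \<Gamma> A a =
     Id_ty (ctx_ext \<Gamma> A) (ty_sub (ctx_ext \<Gamma> A) (proj \<Gamma> A) A)
       (tm_sub (ctx_ext \<Gamma> A) (proj \<Gamma> A) a) (last_var \<Gamma> A)"

definition Id_motive_ctx ::
  "'g psh \<Rightarrow> ('g, 'a) ty \<Rightarrow> ('g, 'a) tm \<Rightarrow> (('g \<times> 'a) \<times> unit) psh" where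
  "Id_motive_ctx \<Gamma> A a = ctx_ext (ctx_ext \<Gamma> A) (Id_motive_ty \<Gamma> A a)"

text \<open>The substitution \<open>(id, b, e) : \<Gamma> \<rightarrow> (\<Gamma>, y : A, w : a =\<^sub>A y)\<close>.\<close>

definition Id_inst ::
  "'g psh \<Rightarrow> ('g, 'a) tm \<Rightarrow> ('g, unit) tm \<Rightarrow> ('g, ('g \<times> 'a) \<times> unit) sub" where
  "Id_inst \<Gamma> b e = sub_ext \<Gamma> (sub_inst \<Gamma> b) e"

text \<open>A term \<open>e\<close> of \<open>a =\<^sub>A b\<close> forces \<open>a[\<gamma>] = b[\<gamma>]\<close> for all \<open>\<gamma>\<close>, so the sets
  \<open>C[(\<gamma>, a[\<gamma>], \<star>)]\<close> and \<open>C[(\<gamma>, b[\<gamma>], \<star>)]\<close> coincide and the eliminator of the presheaf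
  model has the same values as \<open>c\<close>.\<close>

definition J_tm ::
  "('g, 'a) tm \<Rightarrow> ('g, 'a) tm \<Rightarrow> (('g \<times> 'a) \<times> unit, 'c) ty \<Rightarrow> ('g, unit) tm \<Rightarrow> ('g, 'c) tm
     \<Rightarrow> ('g, 'c) tm" where
  "J_tm a b C e c = c"

end

theory Submission
  imports Defs
begin

text \<open>The presheaf constructions satisfy the equations of a CwF with \<open>\<Pi>\<close>, \<open>\<Sigma>\<close> and identity types
  by direct computation; what remains is that they preserve discreteness. For substitution,
  \<open>\<Sigma>\<close> and identity types this is immediate, since the weakening has a section.

  For \<open>\<Pi>\<close>, let \<open>f\<close> lie over a degenerate \<open>\<gamma> = \<gamma>'(\<setminus>i)\<close>, and let \<open>\<phi> : V \<rightarrow> (W, i : \<P>)\<close>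
  and \<open>a \<in> A[\<gamma>\<phi>]\<close>. Degeneracy of \<open>f\<close> in \<open>i\<close> means that \<open>f(\<phi>, a)\<close> does not depend on the value
  of \<open>\<phi>\<close> at \<open>i\<close>. Replace this value by a fresh path variable \<open>j\<close> to get
  \<open>\<psi> : (V, j : \<P>) \<rightarrow> (W, i : \<P>)\<close>. Then \<open>(\<gamma>\<psi>, a\<langle>\<setminus>j\<rangle>)\<close> is degenerate in \<open>j\<close>, hence so is
  \<open>f(\<psi>, a\<langle>\<setminus>j\<rangle>)\<close>, as \<open>B\<close> is discrete, and all instances \<open>f(\<psi>(v/j), a)\<close> coincide.\<close>

section \<open>Face maps\<close>

lemma finite_vars: "finite (vars W)"
  using Rep_bpcube[of W] by (auto simp: vars_def bridge_vars_def path_vars_def)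

lemma bridge_path_disjoint: "bridge_vars W \<inter> path_vars W = {}"
  using Rep_bpcube[of W] by (auto simp: bridge_vars_def path_vars_def)

text \<open>Freshness of \<open>i\<close> keeps bridge and path variables disjoint. Hence the pair
  in \<open>path_ext_def\<close> lies in the representing set and \<open>Abs_bpcube\<close> can be
  inverted on it.\<close>

lemma
  assumes "i \<notin> vars W"
  shows bridge_vars_path_ext: "bridge_vars (path_ext W i) = bridge_vars W"
    and path_vars_path_ext: "path_vars (path_ext W i) = insert i (path_vars W)"
proof -
  have "(bridge_vars W, insert i (path_vars W))
      \<in> {(B, P). finite B \<and> finite P \<and> B \<inter> P = {}}"
    using assms finite_vars[of W] bridge_path_disjoint[of W] by (auto simp: vars_def)
  then have "Rep_bpcube (path_ext W i) = (bridge_vars W, insert i (path_vars W))"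
    unfolding path_ext_def by (rule Abs_bpcube_inverse)
  then show "bridge_vars (path_ext W i) = bridge_vars W"
    "path_vars (path_ext W i) = insert i (path_vars W)"
    by (simp_all add: bridge_vars_def[of "path_ext W i"] path_vars_def[of "path_ext W i"])
qed

lemma vars_path_ext: "i \<notin> vars W \<Longrightarrow> vars (path_ext W i) = insert i (vars W)"
  by (auto simp: vars_def bridge_vars_path_ext path_vars_path_ext)

section \<open>Face maps presented by assignments of values\<close>

definition face_assignment :: "bpcube \<Rightarrow> (nat \<Rightarrow> face_value) \<Rightarrow> bpcube \<Rightarrow> bool" where
  "face_assignment V f W \<longleftrightarrow>
     (\<forall>i\<in>bridge_vars W. f i \<in> {Zero, One} \<union> Var ` bridge_vars V) \<and>
     (\<forall>i\<in>path_vars W. f i \<in> {Zero, One} \<union> Var ` vars V)"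

text \<open>The truncation to the variables of \<open>W\<close> happens here, so
  \<open>face_assignment\<close> can be checked for functions that are not extensional.\<close>

definition mk_face :: "bpcube \<Rightarrow> (nat \<Rightarrow> face_value) \<Rightarrow> bpcube \<Rightarrow> face" where
  "mk_face V f W = Abs_face (V, restrict f (vars W), W)"

lemma
  assumes "face_assignment V f W"
  shows face_dom_mk_face: "face_dom (mk_face V f W) = V"
    and face_cod_mk_face: "face_cod (mk_face V f W) = W"
    and face_map_mk_face: "face_map (mk_face V f W) = restrict f (vars W)"
proof -
  have "Rep_face (mk_face V f W) = (V, restrict f (vars W), W)"
    unfolding mk_face_def
    by (rule Abs_face_inverse)
       (use assms in \<open>simp add: face_assignment_def vars_def\<close>)
  then show "face_dom (mk_face V f W) = V" "face_cod (mk_face V f W) = W"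
    "face_map (mk_face V f W) = restrict f (vars W)"
    by (simp_all add: face_dom_def face_cod_def face_map_def)
qed

lemmas mk_face_simps = face_dom_mk_face face_cod_mk_face face_map_mk_face

lemma face_assignment_face_map: "face_assignment (face_dom \<phi>) (face_map \<phi>) (face_cod \<phi>)"
  using Rep_face[of \<phi>]
  by (auto simp: face_assignment_def face_dom_def face_map_def face_cod_def vars_def)

lemma face_map_extensional: "face_map \<phi> \<in> extensional (vars (face_cod \<phi>))"
  using Rep_face[of \<phi>] by (auto simp: face_map_def face_cod_def)

lemma face_map_cases:
  assumes "i \<in> vars (face_cod \<phi>)"
  obtains "face_map \<phi> i = Zero" | "face_map \<phi> i = One"
    | j where "j \<in> vars (face_dom \<phi>)" "face_map \<phi> i = Var j"
  using assms face_assignment_face_map[of \<phi>] by (auto simp: face_assignment_def vars_def)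

text \<open>Outside the variables of the common codomain both maps have the value
  \<open>undefined\<close>, so comparing the remaining values suffices.\<close>

lemma face_eqI:
  assumes "face_dom \<phi> = face_dom \<psi>" "face_cod \<phi> = face_cod \<psi>"
    and "\<And>i. i \<in> vars (face_cod \<psi>) \<Longrightarrow> face_map \<phi> i = face_map \<psi> i"
  shows "\<phi> = \<psi>"
proof -
  have "face_map \<phi> = face_map \<psi>"
    using extensionalityI[of "face_map \<phi>" "vars (face_cod \<psi>)" "face_map \<psi>"]
      face_map_extensional[of \<phi>] face_map_extensional[of \<psi>] assms by simp
  then have "Rep_face \<phi> = Rep_face \<psi>"
    using assms by (simp add: face_dom_def face_cod_def face_map_def prod_eq_iff)
  then show ?thesis by (simp add: Rep_face_inject)
qed

section \<open>Identities, composition and the category laws\<close>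

lemma face_id_eq: "face_id W = mk_face W Var W"
  by (simp add: face_id_def mk_face_def)

lemma
  shows face_dom_id [simp]: "face_dom (face_id W) = W"
    and face_cod_id [simp]: "face_cod (face_id W) = W"
    and face_map_id: "face_map (face_id W) = restrict Var (vars W)"
proof -
  have "face_assignment W Var W" by (auto simp: face_assignment_def vars_def)
  then show "face_dom (face_id W) = W" "face_cod (face_id W) = W"
    "face_map (face_id W) = restrict Var (vars W)"
    by (simp_all add: face_id_eq mk_face_simps)
qed

lemma face_comp_eq:
  "face_comp \<phi> \<psi> =
     mk_face (face_dom \<psi>) (\<lambda>i. face_subst (face_map \<psi>) (face_map \<phi> i)) (face_cod \<phi>)"
  by (simp add: face_comp_def mk_face_def)

text \<open>The value conditions survive substitution. A bridge variable goes to an endpoint or a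
  bridge variable, and \<psi> sends the latter again to an endpoint or a bridge variable.\<close>

lemma
  assumes "face_dom \<phi> = face_cod \<psi>"
  shows face_dom_comp [simp]: "face_dom (face_comp \<phi> \<psi>) = face_dom \<psi>"
    and face_cod_comp [simp]: "face_cod (face_comp \<phi> \<psi>) = face_cod \<phi>"
    and face_map_comp: "i \<in> vars (face_cod \<phi>) \<Longrightarrow>
      face_map (face_comp \<phi> \<psi>) i = face_subst (face_map \<psi>) (face_map \<phi> i)"
proof -
  have "face_assignment (face_dom \<psi>) (\<lambda>i. face_subst (face_map \<psi>) (face_map \<phi> i)) (face_cod \<phi>)"
    using face_assignment_face_map[of \<phi>] face_assignment_face_map[of \<psi>] assms
    unfolding face_assignment_def vars_def by fastforce
  then show "face_dom (face_comp \<phi> \<psi>) = face_dom \<psi>" "face_cod (face_comp \<phi> \<psi>) = face_cod \<phi>"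
    "i \<in> vars (face_cod \<phi>) \<Longrightarrow>
      face_map (face_comp \<phi> \<psi>) i = face_subst (face_map \<psi>) (face_map \<phi> i)"
    by (simp_all add: face_comp_eq mk_face_simps)
qed

lemma face_comp_id_right [simp]: "face_comp \<phi> (face_id (face_dom \<phi>)) = \<phi>"
proof (rule face_eqI)
  fix i assume i: "i \<in> vars (face_cod \<phi>)"
  show "face_map (face_comp \<phi> (face_id (face_dom \<phi>))) i = face_map \<phi> i"
    by (rule face_map_cases[OF i]) (simp_all add: i face_map_comp face_map_id)
qed simp_all

lemma face_comp_id_left [simp]: "face_comp (face_id (face_cod \<phi>)) \<phi> = \<phi>"
  by (rule face_eqI) (simp_all add: face_map_comp face_map_id)

lemma face_comp_assoc:
  assumes "face_dom \<phi> = face_cod \<psi>" "face_dom \<psi> = face_cod \<chi>"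
  shows "face_comp (face_comp \<phi> \<psi>) \<chi> = face_comp \<phi> (face_comp \<psi> \<chi>)"
proof (rule face_eqI)
  fix i assume "i \<in> vars (face_cod (face_comp \<phi> (face_comp \<psi> \<chi>)))"
  then have i: "i \<in> vars (face_cod \<phi>)" using assms by simp
  show "face_map (face_comp (face_comp \<phi> \<psi>) \<chi>) i =
      face_map (face_comp \<phi> (face_comp \<psi> \<chi>)) i"
    by (rule face_map_cases[OF i]) (use assms i in \<open>simp_all add: face_map_comp\<close>)
qed (use assms in simp_all)

section \<open>Weakenings, their sections, and cylinders on face maps\<close>

lemma weaken_eq: "weaken W i = mk_face (path_ext W i) Var W"
  by (simp add: weaken_def mk_face_def)

lemma
  assumes "i \<notin> vars W"
  shows face_dom_weaken: "face_dom (weaken W i) = path_ext W i"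
    and face_cod_weaken: "face_cod (weaken W i) = W"
    and face_map_weaken: "face_map (weaken W i) = restrict Var (vars W)"
proof -
  have "face_assignment (path_ext W i) Var W"
    using assms by (auto simp: face_assignment_def vars_path_ext bridge_vars_path_ext)
       (auto simp: vars_def)
  then show "face_dom (weaken W i) = path_ext W i" "face_cod (weaken W i) = W"
    "face_map (weaken W i) = restrict Var (vars W)"
    by (simp_all add: weaken_eq mk_face_simps)
qed

lemmas weaken_simps = face_dom_weaken face_cod_weaken face_map_weaken

text \<open>The face map \<open>(v/i) : W \<rightarrow> (W, i : \<P>)\<close>, a section of the weakening.\<close>

definition path_inst :: "bpcube \<Rightarrow> nat \<Rightarrow> face_value \<Rightarrow> face" where
  "path_inst W i v = mk_face W (Var(i := v)) (path_ext W i)"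

text \<open>Since \<open>i\<close> is added as a path variable, every endpoint and every variable of
  \<open>W\<close>, bridge or path, is an admissible value for it.\<close>

lemma
  assumes "i \<notin> vars W" "v \<in> {Zero, One} \<union> Var ` vars W"
  shows face_dom_path_inst: "face_dom (path_inst W i v) = W"
    and face_cod_path_inst: "face_cod (path_inst W i v) = path_ext W i"
    and face_map_path_inst: "face_map (path_inst W i v) = restrict (Var(i := v)) (insert i (vars W))"
proof -
  have "face_assignment W (Var(i := v)) (path_ext W i)"
    using assms
    by (auto simp: face_assignment_def bridge_vars_path_ext path_vars_path_ext)
       (auto simp: vars_def)
  then show "face_dom (path_inst W i v) = W" "face_cod (path_inst W i v) = path_ext W i"
    "face_map (path_inst W i v) = restrict (Var(i := v)) (insert i (vars W))"
    using assms by (simp_all add: path_inst_def mk_face_simps vars_path_ext)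
qed

lemmas path_inst_simps = face_dom_path_inst face_cod_path_inst face_map_path_inst

text \<open>The weakening uses only the variables of \<open>W\<close>, and \<open>i\<close> is not
  among them, so the value \<open>v\<close> is never read.\<close>

lemma weaken_path_inst:
  assumes "i \<notin> vars W" "v \<in> {Zero, One} \<union> Var ` vars W"
  shows "face_comp (weaken W i) (path_inst W i v) = face_id W"
  by (rule face_eqI)
     (use assms in \<open>auto simp: weaken_simps path_inst_simps face_map_comp face_map_id\<close>)

text \<open>Replacing the value of \<open>\<phi>\<close> at \<open>i\<close> by a fresh path variable \<open>j\<close> connects \<open>\<phi>\<close> to the
  face map that agrees with it except that it sends \<open>i\<close> to \<open>0\<close>. This is possible because a path
  variable may be instantiated by any value that \<open>\<phi>\<close> may take at \<open>i\<close>.\<close>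

definition path_cylinder :: "face \<Rightarrow> nat \<Rightarrow> nat \<Rightarrow> face" where
  "path_cylinder \<phi> i j =
     mk_face (path_ext (face_dom \<phi>) j) ((face_map \<phi>)(i := Var j)) (face_cod \<phi>)"

text \<open>The new value is admissible because \<open>i\<close> is a path variable of the codomain,
  and may therefore be sent to the path variable \<open>j\<close> of the extended domain.\<close>

lemma
  assumes "face_cod \<phi> = path_ext W i" "i \<notin> vars W" "j \<notin> vars (face_dom \<phi>)"
  shows face_dom_path_cylinder: "face_dom (path_cylinder \<phi> i j) = path_ext (face_dom \<phi>) j"
    and face_cod_path_cylinder: "face_cod (path_cylinder \<phi> i j) = path_ext W i"
    and face_map_path_cylinder:
      "face_map (path_cylinder \<phi> i j) = restrict ((face_map \<phi>)(i := Var j)) (insert i (vars W))"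
proof -
  have "face_assignment (path_ext (face_dom \<phi>) j) ((face_map \<phi>)(i := Var j)) (face_cod \<phi>)"
    using assms face_assignment_face_map[of \<phi>]
    by (auto simp: face_assignment_def bridge_vars_path_ext path_vars_path_ext vars_path_ext)
       (auto simp: vars_def)
  then show "face_dom (path_cylinder \<phi> i j) = path_ext (face_dom \<phi>) j"
    "face_cod (path_cylinder \<phi> i j) = path_ext W i"
    "face_map (path_cylinder \<phi> i j) = restrict ((face_map \<phi>)(i := Var j)) (insert i (vars W))"
    using assms by (simp_all add: path_cylinder_def mk_face_simps vars_path_ext)
qed

lemmas path_cylinder_simps = face_dom_path_cylinder face_cod_path_cylinder face_map_path_cylinder

text \<open>The first two equations compute two instances of the cylinder: \<phi> itself, and \<phi>
  with its value at \<open>i\<close> reset to 0. The third expresses that only the value at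
  \<open>i\<close> varies along \<open>j\<close>; thus a context element degenerate in
  \<open>i\<close> becomes degenerate in \<open>j\<close> when restricted along the
  cylinder.\<close>

lemma
  assumes "face_cod \<phi> = path_ext W i" "i \<notin> vars W" "j \<notin> vars (face_dom \<phi>)"
  shows path_cylinder_inst_self:
      "face_comp (path_cylinder \<phi> i j) (path_inst (face_dom \<phi>) j (face_map \<phi> i)) = \<phi>"
    and path_cylinder_inst_Zero:
      "face_comp (path_cylinder \<phi> i j) (path_inst (face_dom \<phi>) j Zero) =
         face_comp (path_inst W i Zero) (face_comp (weaken W i) \<phi>)"
    and weaken_path_cylinder:
      "face_comp (weaken W i) (path_cylinder \<phi> i j) =
         face_comp (face_comp (weaken W i) \<phi>) (weaken (face_dom \<phi>) j)"
proof -
  have val: "face_map \<phi> k \<in> {Zero, One} \<union> Var ` vars (face_dom \<phi>)" if "k \<in> insert i (vars W)" for k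
    using that assms face_assignment_face_map[of \<phi>]
    by (auto simp: face_assignment_def bridge_vars_path_ext path_vars_path_ext)
       (auto simp: vars_def)
  have vi: "face_map \<phi> i \<in> {Zero, One} \<union> Var ` vars (face_dom \<phi>)" using val by simp
  \<comment> \<open>As \<open>j\<close> is fresh for the domain of \<phi>, no value of \<phi> is
    \<open>Var j\<close>. Neither instantiating \<open>j\<close> nor weakening by it changes these
    values.\<close>
  have *: "face_subst (restrict (Var(j := v)) (insert j (vars (face_dom \<phi>)))) (face_map \<phi> k) = face_map \<phi> k"
    "face_subst (restrict Var (vars (face_dom \<phi>))) (face_map \<phi> k) = face_map \<phi> k"
    if "k \<in> insert i (vars W)" for k v
    using val[OF that] assms by auto
  show "face_comp (path_cylinder \<phi> i j) (path_inst (face_dom \<phi>) j (face_map \<phi> i)) = \<phi>"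
    by (rule face_eqI)
       (use assms vi * in \<open>auto simp: path_cylinder_simps path_inst_simps face_map_comp vars_path_ext\<close>)
  show "face_comp (path_cylinder \<phi> i j) (path_inst (face_dom \<phi>) j Zero) =
         face_comp (path_inst W i Zero) (face_comp (weaken W i) \<phi>)"
    by (rule face_eqI)
       (use assms * in \<open>auto simp: path_cylinder_simps path_inst_simps weaken_simps
          face_map_comp vars_path_ext\<close>)
  show "face_comp (weaken W i) (path_cylinder \<phi> i j) =
         face_comp (face_comp (weaken W i) \<phi>) (weaken (face_dom \<phi>) j)"
    by (rule face_eqI)
       (use assms * in \<open>auto simp: path_cylinder_simps weaken_simps face_map_comp vars_path_ext\<close>)
qed

section \<open>The presheaf CwF\<close>

lemma
  assumes "is_psh \<Gamma>"
  shows res_in: "\<gamma> \<in> el \<Gamma> (face_cod \<phi>) \<Longrightarrow> res \<Gamma> \<phi> \<gamma> \<in> el \<Gamma> (face_dom \<phi>)"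
    and res_id: "\<gamma> \<in> el \<Gamma> W \<Longrightarrow> res \<Gamma> (face_id W) \<gamma> = \<gamma>"
    and res_comp: "face_dom \<phi> = face_cod \<psi> \<Longrightarrow> \<gamma> \<in> el \<Gamma> (face_cod \<phi>) \<Longrightarrow>
      res \<Gamma> (face_comp \<phi> \<psi>) \<gamma> = res \<Gamma> \<psi> (res \<Gamma> \<phi> \<gamma>)"
  using assms by (auto simp: is_psh_def extensional_def)

lemma is_subD:
  assumes "is_sub \<Delta> \<Gamma> \<sigma>"
  shows sub_in: "\<delta> \<in> el \<Delta> W \<Longrightarrow> \<sigma> W \<delta> \<in> el \<Gamma> W"
    and sub_res: "\<delta> \<in> el \<Delta> (face_cod \<phi>) \<Longrightarrow>
      \<sigma> (face_dom \<phi>) (res \<Delta> \<phi> \<delta>) = res \<Gamma> \<phi> (\<sigma> (face_cod \<phi>) \<delta>)"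
    and sub_undefined: "\<delta> \<notin> el \<Delta> W \<Longrightarrow> \<sigma> W \<delta> = undefined"
  using assms by (auto simp: is_sub_def PiE_def extensional_def)

lemma is_subI:
  assumes "\<And>W \<delta>. \<delta> \<in> el \<Delta> W \<Longrightarrow> \<sigma> W \<delta> \<in> el \<Gamma> W"
    and "\<And>W \<delta>. \<delta> \<notin> el \<Delta> W \<Longrightarrow> \<sigma> W \<delta> = undefined"
    and "\<And>\<phi> \<delta>. \<delta> \<in> el \<Delta> (face_cod \<phi>) \<Longrightarrow>
      \<sigma> (face_dom \<phi>) (res \<Delta> \<phi> \<delta>) = res \<Gamma> \<phi> (\<sigma> (face_cod \<phi>) \<delta>)"
  shows "is_sub \<Delta> \<Gamma> \<sigma>"
  using assms by (auto simp: is_sub_def PiE_def extensional_def)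

lemma
  assumes "is_ty \<Gamma> T"
  shows fres_in: "\<gamma> \<in> el \<Gamma> (face_cod \<phi>) \<Longrightarrow> t \<in> fib T (face_cod \<phi>) \<gamma> \<Longrightarrow>
      fres T \<phi> \<gamma> t \<in> fib T (face_dom \<phi>) (res \<Gamma> \<phi> \<gamma>)"
    and fres_id: "\<gamma> \<in> el \<Gamma> W \<Longrightarrow> t \<in> fib T W \<gamma> \<Longrightarrow> fres T (face_id W) \<gamma> t = t"
    and fres_comp: "face_dom \<phi> = face_cod \<psi> \<Longrightarrow> \<gamma> \<in> el \<Gamma> (face_cod \<phi>) \<Longrightarrow>
      t \<in> fib T (face_cod \<phi>) \<gamma> \<Longrightarrow>
      fres T (face_comp \<phi> \<psi>) \<gamma> t = fres T \<psi> (res \<Gamma> \<phi> \<gamma>) (fres T \<phi> \<gamma> t)"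
    and fib_empty: "\<gamma> \<notin> el \<Gamma> W \<Longrightarrow> fib T W \<gamma> = {}"
    and fres_undefined: "t \<notin> fib T (face_cod \<phi>) \<gamma> \<Longrightarrow> fres T \<phi> \<gamma> t = undefined"
  using assms by (auto simp: is_ty_def extensional_def)

lemma is_tyI:
  assumes "\<And>\<phi> \<gamma> t. \<gamma> \<in> el \<Gamma> (face_cod \<phi>) \<Longrightarrow> t \<in> fib T (face_cod \<phi>) \<gamma> \<Longrightarrow>
      fres T \<phi> \<gamma> t \<in> fib T (face_dom \<phi>) (res \<Gamma> \<phi> \<gamma>)"
    and "\<And>W \<gamma> t. \<gamma> \<in> el \<Gamma> W \<Longrightarrow> t \<in> fib T W \<gamma> \<Longrightarrow> fres T (face_id W) \<gamma> t = t"
    and "\<And>\<phi> \<psi> \<gamma> t. face_dom \<phi> = face_cod \<psi> \<Longrightarrow> \<gamma> \<in> el \<Gamma> (face_cod \<phi>) \<Longrightarrow>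
      t \<in> fib T (face_cod \<phi>) \<gamma> \<Longrightarrow>
      fres T (face_comp \<phi> \<psi>) \<gamma> t = fres T \<psi> (res \<Gamma> \<phi> \<gamma>) (fres T \<phi> \<gamma> t)"
    and "\<And>W \<gamma>. \<gamma> \<notin> el \<Gamma> W \<Longrightarrow> fib T W \<gamma> = {}"
    and "\<And>\<phi> \<gamma> t. t \<notin> fib T (face_cod \<phi>) \<gamma> \<Longrightarrow> fres T \<phi> \<gamma> t = undefined"
  shows "is_ty \<Gamma> T"
  using assms by (auto simp: is_ty_def extensional_def)

text \<open>The type annotation closes the record, so its two fields determine it. Truncation makes
  the comparison meaningful for all arguments and not only for elements of the context.\<close>

lemma ty_eqI:
  assumes "\<And>W \<gamma>. fib S W \<gamma> = fib T W \<gamma>"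
    and "\<And>\<phi> \<gamma> t. fres S \<phi> \<gamma> t = fres T \<phi> \<gamma> t"
  shows "S = (T :: ('g, 'a) ty)"
  by (rule ty.equality) (use assms in \<open>auto intro!: ext\<close>)

lemma
  assumes "is_tm \<Gamma> T t"
  shows tm_in: "\<gamma> \<in> el \<Gamma> W \<Longrightarrow> t W \<gamma> \<in> fib T W \<gamma>"
    and tm_res: "\<gamma> \<in> el \<Gamma> (face_cod \<phi>) \<Longrightarrow>
      t (face_dom \<phi>) (res \<Gamma> \<phi> \<gamma>) = fres T \<phi> \<gamma> (t (face_cod \<phi>) \<gamma>)"
    and tm_undefined: "\<gamma> \<notin> el \<Gamma> W \<Longrightarrow> t W \<gamma> = undefined"
  using assms by (auto simp: is_tm_def PiE_def extensional_def)

lemma is_tmI: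
  assumes "\<And>W \<gamma>. \<gamma> \<in> el \<Gamma> W \<Longrightarrow> t W \<gamma> \<in> fib T W \<gamma>"
    and "\<And>W \<gamma>. \<gamma> \<notin> el \<Gamma> W \<Longrightarrow> t W \<gamma> = undefined"
    and "\<And>\<phi> \<gamma>. \<gamma> \<in> el \<Gamma> (face_cod \<phi>) \<Longrightarrow>
      t (face_dom \<phi>) (res \<Gamma> \<phi> \<gamma>) = fres T \<phi> \<gamma> (t (face_cod \<phi>) \<gamma>)"
  shows "is_tm \<Gamma> T t"
  using assms by (auto simp: is_tm_def PiE_def extensional_def)

section \<open>The category of contexts and substitutions\<close>

lemma is_sub_id: "is_psh \<Gamma> \<Longrightarrow> is_sub \<Gamma> \<Gamma> (sub_id \<Gamma>)"
  by (rule is_subI) (auto simp: sub_id_def res_in)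

lemma is_sub_comp:
  assumes "is_psh \<Theta>" "is_sub \<Delta> \<Gamma> \<sigma>" "is_sub \<Theta> \<Delta> \<tau>"
  shows "is_sub \<Theta> \<Gamma> (sub_comp \<Theta> \<sigma> \<tau>)"
  by (rule is_subI)
     (use assms in \<open>auto simp: sub_comp_def res_in sub_in[OF assms(2)] sub_in[OF assms(3)]
        sub_res[OF assms(2)] sub_res[OF assms(3)]\<close>)

text \<open>Off the elements of \<Delta> both sides are \<open>undefined\<close> by the
  extensionality in \<open>is_sub\<close>, so the unit laws hold as equations of HOL
  functions.\<close>

lemma sub_comp_id:
  assumes "is_sub \<Delta> \<Gamma> \<sigma>"
  shows "sub_comp \<Delta> (sub_id \<Gamma>) \<sigma> = \<sigma>" "sub_comp \<Delta> \<sigma> (sub_id \<Delta>) = \<sigma>"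
  by (auto intro!: ext simp: sub_comp_def sub_id_def restrict_def is_subD[OF assms])

text \<open>Because \<upsilon> lands in \<Theta>, the truncation built into
  \<open>sub_comp \<Theta> \<sigma> \<tau>\<close> has no effect after composing with
  \<upsilon>.\<close>

lemma sub_comp_assoc:
  assumes "is_sub \<Xi> \<Theta> \<upsilon>"
  shows "sub_comp \<Xi> (sub_comp \<Theta> \<sigma> \<tau>) \<upsilon> = sub_comp \<Xi> \<sigma> (sub_comp \<Xi> \<tau> \<upsilon>)"
  by (auto intro!: ext simp: sub_comp_def restrict_def is_subD[OF assms])

lemma is_psh_empty_ctx: "is_psh empty_ctx"
  by (auto simp: is_psh_def empty_ctx_def extensional_def)

lemma ex1_sub_empty_ctx: "\<exists>!\<sigma>. is_sub \<Gamma> empty_ctx \<sigma>"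
proof
  show "is_sub \<Gamma> empty_ctx (\<lambda>_ _. ())" by (rule is_subI) (auto simp: empty_ctx_def)
qed (auto intro!: ext)

section \<open>Action of substitutions on types and terms\<close>

lemma fib_ty_sub: "fib (ty_sub \<Delta> \<sigma> T) W \<delta> = (if \<delta> \<in> el \<Delta> W then fib T W (\<sigma> W \<delta>) else {})"
  by (simp add: ty_sub_def)

lemma fres_ty_sub:
  "fres (ty_sub \<Delta> \<sigma> T) \<phi> \<delta> t =
     (if \<delta> \<in> el \<Delta> (face_cod \<phi>) then fres T \<phi> (\<sigma> (face_cod \<phi>) \<delta>) t else undefined)"
  by (simp add: ty_sub_def)

lemma is_ty_ty_sub:
  assumes "is_psh \<Delta>" "is_sub \<Delta> \<Gamma> \<sigma>" "is_ty \<Gamma> T"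
  shows "is_ty \<Delta> (ty_sub \<Delta> \<sigma> T)"
proof (rule is_tyI)
  fix \<phi> \<delta> t assume "\<delta> \<in> el \<Delta> (face_cod \<phi>)" "t \<in> fib (ty_sub \<Delta> \<sigma> T) (face_cod \<phi>) \<delta>"
  then show "fres (ty_sub \<Delta> \<sigma> T) \<phi> \<delta> t \<in> fib (ty_sub \<Delta> \<sigma> T) (face_dom \<phi>) (res \<Delta> \<phi> \<delta>)"
    using assms(1)
    by (simp add: fib_ty_sub fres_ty_sub res_in sub_res[OF assms(2)] fres_in[OF assms(3)]
        sub_in[OF assms(2)])
next
  fix \<phi> \<psi> \<delta> t
  assume "face_dom \<phi> = face_cod \<psi>" "\<delta> \<in> el \<Delta> (face_cod \<phi>)"
    "t \<in> fib (ty_sub \<Delta> \<sigma> T) (face_cod \<phi>) \<delta>"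
  then show "fres (ty_sub \<Delta> \<sigma> T) (face_comp \<phi> \<psi>) \<delta> t =
      fres (ty_sub \<Delta> \<sigma> T) \<psi> (res \<Delta> \<phi> \<delta>) (fres (ty_sub \<Delta> \<sigma> T) \<phi> \<delta> t)"
    using res_in[OF assms(1), of \<delta> \<phi>] sub_res[OF assms(2), of \<delta> \<phi>]
    by (simp add: fib_ty_sub fres_ty_sub sub_in[OF assms(2)] fres_comp[OF assms(3)])
qed (auto simp: fib_ty_sub fres_ty_sub sub_in[OF assms(2)] fres_id[OF assms(3)]
      fres_undefined[OF assms(3)])

lemma is_tm_tm_sub:
  assumes "is_psh \<Delta>" "is_sub \<Delta> \<Gamma> \<sigma>" "is_tm \<Gamma> T t"
  shows "is_tm \<Delta> (ty_sub \<Delta> \<sigma> T) (tm_sub \<Delta> \<sigma> t)"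
  by (rule is_tmI)
     (auto simp: tm_sub_def fib_ty_sub fres_ty_sub res_in[OF assms(1)] sub_in[OF assms(2)]
        sub_res[OF assms(2)] tm_in[OF assms(3)] tm_res[OF assms(3)])

text \<open>Off the elements of \<Gamma> the left-hand type is empty by truncation, and
  \<open>T\<close> is empty there by \<open>is_ty\<close>.\<close>

lemma ty_sub_id: "is_ty \<Gamma> T \<Longrightarrow> ty_sub \<Gamma> (sub_id \<Gamma>) T = T"
  by (rule ty_eqI) (auto simp: fib_ty_sub fres_ty_sub sub_id_def fib_empty fres_undefined)

lemma tm_sub_id: "is_tm \<Gamma> T t \<Longrightarrow> tm_sub \<Gamma> (sub_id \<Gamma>) t = t"
  by (auto intro!: ext simp: tm_sub_def sub_id_def restrict_def tm_undefined)

text \<open>As \<tau> lands in \<Delta>, the truncation of \<open>ty_sub \<Delta> \<sigma> T\<close>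
  to the elements of \<Delta> cuts nothing off.\<close>

lemma ty_sub_comp:
  assumes "is_sub \<Theta> \<Delta> \<tau>"
  shows "ty_sub \<Theta> (sub_comp \<Theta> \<sigma> \<tau>) T = ty_sub \<Theta> \<tau> (ty_sub \<Delta> \<sigma> T)"
  by (rule ty_eqI) (auto simp: fib_ty_sub fres_ty_sub sub_comp_def sub_in[OF assms])

lemma tm_sub_comp:
  assumes "is_sub \<Theta> \<Delta> \<tau>"
  shows "tm_sub \<Theta> (sub_comp \<Theta> \<sigma> \<tau>) t = tm_sub \<Theta> \<tau> (tm_sub \<Delta> \<sigma> t)"
  by (auto intro!: ext simp: tm_sub_def sub_comp_def restrict_def sub_in[OF assms])

section \<open>Context extension and its universal property\<close>

lemma el_ctx_ext: "(\<gamma>, t) \<in> el (ctx_ext \<Gamma> T) W \<longleftrightarrow> \<gamma> \<in> el \<Gamma> W \<and> t \<in> fib T W \<gamma>"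
  by (simp add: ctx_ext_def)

lemma res_ctx_ext:
  "res (ctx_ext \<Gamma> T) \<phi> (\<gamma>, t) =
     (if \<gamma> \<in> el \<Gamma> (face_cod \<phi>) \<and> t \<in> fib T (face_cod \<phi>) \<gamma>
      then (res \<Gamma> \<phi> \<gamma>, fres T \<phi> \<gamma> t) else undefined)"
  by (simp add: ctx_ext_def)

lemma is_psh_ctx_ext:
  assumes "is_psh \<Gamma>" "is_ty \<Gamma> T"
  shows "is_psh (ctx_ext \<Gamma> T)"
  unfolding is_psh_def extensional_def using assms
  by (auto simp: el_ctx_ext res_ctx_ext res_in res_id res_comp fres_in fres_id fres_comp)
     (metis res_in fres_in)+

lemma proj_apply:
  "proj \<Gamma> T W (\<gamma>, t) = (if \<gamma> \<in> el \<Gamma> W \<and> t \<in> fib T W \<gamma> then \<gamma> else undefined)"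
  by (simp add: proj_def el_ctx_ext)

lemma last_var_apply:
  "last_var \<Gamma> T W (\<gamma>, t) = (if \<gamma> \<in> el \<Gamma> W \<and> t \<in> fib T W \<gamma> then t else undefined)"
  by (simp add: last_var_def el_ctx_ext)

lemma is_sub_proj:
  assumes "is_psh \<Gamma>" "is_ty \<Gamma> T"
  shows "is_sub (ctx_ext \<Gamma> T) \<Gamma> (proj \<Gamma> T)"
  using assms
  by (intro is_subI; clarsimp simp: el_ctx_ext res_ctx_ext proj_apply)
     (auto simp: res_in fres_in)

lemma is_tm_last_var:
  assumes "is_psh \<Gamma>" "is_ty \<Gamma> T"
  shows "is_tm (ctx_ext \<Gamma> T) (ty_sub (ctx_ext \<Gamma> T) (proj \<Gamma> T) T) (last_var \<Gamma> T)"
  using assms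
  by (intro is_tmI; clarsimp simp: el_ctx_ext res_ctx_ext last_var_apply proj_apply fib_ty_sub fres_ty_sub)
     (auto simp: res_in fres_in)

lemma is_sub_sub_ext:
  assumes "is_psh \<Delta>" "is_sub \<Delta> \<Gamma> \<sigma>" "is_tm \<Delta> (ty_sub \<Delta> \<sigma> T) t"
  shows "is_sub \<Delta> (ctx_ext \<Gamma> T) (sub_ext \<Delta> \<sigma> t)"
proof (rule is_subI)
  have t: "t W \<delta> \<in> fib T W (\<sigma> W \<delta>)" if "\<delta> \<in> el \<Delta> W" for W \<delta>
    using tm_in[OF assms(3) that] that by (simp add: fib_ty_sub)
  fix W \<delta> assume "\<delta> \<in> el \<Delta> W"
  then show "sub_ext \<Delta> \<sigma> t W \<delta> \<in> el (ctx_ext \<Gamma> T) W"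
    by (simp add: sub_ext_def el_ctx_ext sub_in[OF assms(2)] t)
next
  have t: "t W \<delta> \<in> fib T W (\<sigma> W \<delta>)" if "\<delta> \<in> el \<Delta> W" for W \<delta>
    using tm_in[OF assms(3) that] that by (simp add: fib_ty_sub)
  fix \<phi> \<delta> assume "\<delta> \<in> el \<Delta> (face_cod \<phi>)"
  then show "sub_ext \<Delta> \<sigma> t (face_dom \<phi>) (res \<Delta> \<phi> \<delta>) =
      res (ctx_ext \<Gamma> T) \<phi> (sub_ext \<Delta> \<sigma> t (face_cod \<phi>) \<delta>)"
    by (simp add: sub_ext_def res_ctx_ext res_in[OF assms(1)] sub_in[OF assms(2)]
        sub_res[OF assms(2)] tm_res[OF assms(3)] fres_ty_sub t)
qed (simp add: sub_ext_def)

lemma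
  assumes "is_sub \<Delta> \<Gamma> \<sigma>" "is_tm \<Delta> (ty_sub \<Delta> \<sigma> T) t"
  shows proj_sub_ext: "sub_comp \<Delta> (proj \<Gamma> T) (sub_ext \<Delta> \<sigma> t) = \<sigma>"
    and last_var_sub_ext: "tm_sub \<Delta> (sub_ext \<Delta> \<sigma> t) (last_var \<Gamma> T) = t"
proof -
  have t: "t W \<delta> \<in> fib T W (\<sigma> W \<delta>)" if "\<delta> \<in> el \<Delta> W" for W \<delta>
    using tm_in[OF assms(2) that] that by (simp add: fib_ty_sub)
  show "sub_comp \<Delta> (proj \<Gamma> T) (sub_ext \<Delta> \<sigma> t) = \<sigma>"
    by (auto intro!: ext simp: sub_comp_def sub_ext_def restrict_def proj_apply t is_subD[OF assms(1)])
  show "tm_sub \<Delta> (sub_ext \<Delta> \<sigma> t) (last_var \<Gamma> T) = t"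
    by (auto intro!: ext simp: tm_sub_def sub_ext_def restrict_def last_var_apply t
        sub_in[OF assms(1)] tm_undefined[OF assms(2)])
qed

lemma sub_ext_unique:
  assumes "is_sub \<Delta> (ctx_ext \<Gamma> T) \<rho>"
    and "sub_comp \<Delta> (proj \<Gamma> T) \<rho> = \<sigma>" "tm_sub \<Delta> \<rho> (last_var \<Gamma> T) = t"
  shows "\<rho> = sub_ext \<Delta> \<sigma> t"
proof (intro ext)
  fix W \<delta>
  show "\<rho> W \<delta> = sub_ext \<Delta> \<sigma> t W \<delta>"
    \<comment> \<open>Writing \<sigma> and \<open>t\<close> as the two components of \<rho> reduces
      the claim to surjective pairing on elements of \<Delta> and to \<open>undefined\<close>
      elsewhere.\<close>
    unfolding assms(2,3)[symmetric]
    using sub_in[OF assms(1), of \<delta> W] sub_undefined[OF assms(1), of \<delta> W]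
    by (cases "\<rho> W \<delta>") (auto simp: sub_ext_def sub_comp_def tm_sub_def proj_apply last_var_apply el_ctx_ext)
qed

lemma sub_lift_apply:
  "sub_lift \<Delta> \<sigma> T W (\<delta>, t) =
     (if \<delta> \<in> el \<Delta> W \<and> t \<in> fib T W (\<sigma> W \<delta>) then (\<sigma> W \<delta>, t) else undefined)"
  by (auto simp: sub_lift_def Let_def sub_ext_def sub_comp_def el_ctx_ext fib_ty_sub
      proj_apply last_var_apply)

section \<open>Discreteness and its stability under substitution\<close>

lemma discreteD:
  assumes "discrete \<Gamma> T" "is_psh \<Gamma>" "i \<notin> vars W" "\<gamma> \<in> el \<Gamma> W"
    and "t \<in> fib T (path_ext W i) (res \<Gamma> (weaken W i) \<gamma>)"
  obtains t' where "t' \<in> fib T W \<gamma>" "t = fres T (weaken W i) \<gamma> t'"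
proof -
  let ?w = "weaken W i" and ?s = "path_inst W i Zero"
  have "res \<Gamma> ?w \<gamma> \<in> el \<Gamma> (path_ext W i)"
    using res_in[OF assms(2), of \<gamma> ?w] assms by (simp add: weaken_simps)
  then obtain \<gamma>' t' where g: "\<gamma>' \<in> el \<Gamma> W" "res \<Gamma> ?w \<gamma> = res \<Gamma> ?w \<gamma>'"
    and t: "t' \<in> fib T W \<gamma>'" "t = fres T ?w \<gamma>' t'"
    using assms unfolding discrete_def ctx_degenerate_def ty_degenerate_def by blast
  \<comment> \<open>The definition of discreteness gives a preimage over some \<gamma>' that has the
    same degeneracy as \<gamma>. Restriction along a section of the weakening shows that \<gamma>'
    is \<gamma>, so the preimage lies in the intended fibre.\<close>
  have "res \<Gamma> ?s (res \<Gamma> ?w \<gamma>'') = \<gamma>''" if "\<gamma>'' \<in> el \<Gamma> W" for \<gamma>''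
    using res_comp[OF assms(2), of ?w ?s \<gamma>''] that assms(3)
    by (simp add: weaken_simps path_inst_simps weaken_path_inst res_id[OF assms(2)])
  then have "\<gamma>' = \<gamma>" using g assms(4) by metis
  with t that show thesis by blast
qed

lemma discreteI:
  assumes "\<And>W i \<gamma> t. i \<notin> vars W \<Longrightarrow> \<gamma> \<in> el \<Gamma> W \<Longrightarrow>
      t \<in> fib T (path_ext W i) (res \<Gamma> (weaken W i) \<gamma>) \<Longrightarrow>
      \<exists>t'\<in>fib T W \<gamma>. t = fres T (weaken W i) \<gamma> t'"
  shows "discrete \<Gamma> T"
  unfolding discrete_def ctx_degenerate_def ty_degenerate_def using assms by blast

text \<open>By naturality, \<sigma> sends the degeneracy of \<delta> to the degeneracy of
  \<open>\<sigma> W \<delta>\<close>. A preimage found there by discreteness of \<open>T\<close>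
  lies in the fibre of the substituted type over \<delta>.\<close>

lemma discrete_ty_sub:
  assumes "is_psh \<Delta>" "is_psh \<Gamma>" "is_sub \<Delta> \<Gamma> \<sigma>" "discrete \<Gamma> T"
  shows "discrete \<Delta> (ty_sub \<Delta> \<sigma> T)"
proof (rule discreteI)
  fix W i \<delta> t
  assume i: "i \<notin> vars W" and d: "\<delta> \<in> el \<Delta> W"
    and "t \<in> fib (ty_sub \<Delta> \<sigma> T) (path_ext W i) (res \<Delta> (weaken W i) \<delta>)"
  then have "t \<in> fib T (path_ext W i) (res \<Gamma> (weaken W i) (\<sigma> W \<delta>))"
    using sub_res[OF assms(3), of \<delta> "weaken W i"]
    by (simp add: fib_ty_sub weaken_simps split: if_splits)
  from discreteD[OF assms(4,2) i sub_in[OF assms(3) d] this]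
  show "\<exists>t'\<in>fib (ty_sub \<Delta> \<sigma> T) W \<delta>. t = fres (ty_sub \<Delta> \<sigma> T) (weaken W i) \<delta> t'"
    using i d by (auto simp: fib_ty_sub fres_ty_sub weaken_simps)
qed

section \<open>Dependent sums\<close>

lemma fib_Sigma_ty: "(a, b) \<in> fib (Sigma_ty \<Gamma> A B) W \<gamma> \<longleftrightarrow> a \<in> fib A W \<gamma> \<and> b \<in> fib B W (\<gamma>, a)"
  by (simp add: Sigma_ty_def)

lemma fres_Sigma_ty:
  "fres (Sigma_ty \<Gamma> A B) \<phi> \<gamma> (a, b) =
     (if a \<in> fib A (face_cod \<phi>) \<gamma> \<and> b \<in> fib B (face_cod \<phi>) (\<gamma>, a)
      then (fres A \<phi> \<gamma> a, fres B \<phi> (\<gamma>, a) b) else undefined)"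
  by (simp add: Sigma_ty_def)

lemma is_ty_Sigma_ty:
  assumes "is_psh \<Gamma>" "is_ty \<Gamma> A" "is_ty (ctx_ext \<Gamma> A) B"
  shows "is_ty \<Gamma> (Sigma_ty \<Gamma> A B)"
proof (rule is_tyI; (clarsimp simp: fib_Sigma_ty fres_Sigma_ty)?)
  fix \<phi> \<gamma> a b
  assume "\<gamma> \<in> el \<Gamma> (face_cod \<phi>)" "a \<in> fib A (face_cod \<phi>) \<gamma>" "b \<in> fib B (face_cod \<phi>) (\<gamma>, a)"
  then show "fres A \<phi> \<gamma> a \<in> fib A (face_dom \<phi>) (res \<Gamma> \<phi> \<gamma>) \<and>
      fres B \<phi> (\<gamma>, a) b \<in> fib B (face_dom \<phi>) (res \<Gamma> \<phi> \<gamma>, fres A \<phi> \<gamma> a)"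
    using fres_in[OF assms(3), of "(\<gamma>, a)" \<phi> b]
    by (simp add: el_ctx_ext res_ctx_ext fres_in[OF assms(2)])
next
  fix W \<gamma> a b assume "\<gamma> \<in> el \<Gamma> W" "a \<in> fib A W \<gamma>" "b \<in> fib B W (\<gamma>, a)"
  then show "fres A (face_id W) \<gamma> a = a \<and> fres B (face_id W) (\<gamma>, a) b = b"
    by (simp add: fres_id[OF assms(2)] fres_id[OF assms(3)] el_ctx_ext)
next
  fix \<phi> \<psi> \<gamma> a b
  assume "face_dom \<phi> = face_cod \<psi>"
    "\<gamma> \<in> el \<Gamma> (face_cod \<phi>)" "a \<in> fib A (face_cod \<phi>) \<gamma>" "b \<in> fib B (face_cod \<phi>) (\<gamma>, a)"
  \<comment> \<open>The two implications come from the case distinction in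
    \<open>fres_Sigma_ty\<close>. The premise of the second, which leads to the default value,
    contradicts the closure of \<open>A\<close> and \<open>B\<close> under restriction.\<close>
  then show "(fres A \<phi> \<gamma> a \<in> fib A (face_cod \<psi>) (res \<Gamma> \<phi> \<gamma>) \<and>
        fres B \<phi> (\<gamma>, a) b \<in> fib B (face_cod \<psi>) (res \<Gamma> \<phi> \<gamma>, fres A \<phi> \<gamma> a) \<longrightarrow>
        fres A (face_comp \<phi> \<psi>) \<gamma> a = fres A \<psi> (res \<Gamma> \<phi> \<gamma>) (fres A \<phi> \<gamma> a) \<and>
        fres B (face_comp \<phi> \<psi>) (\<gamma>, a) b =
          fres B \<psi> (res \<Gamma> \<phi> \<gamma>, fres A \<phi> \<gamma> a) (fres B \<phi> (\<gamma>, a) b)) \<and>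
      ((fres A \<phi> \<gamma> a \<in> fib A (face_cod \<psi>) (res \<Gamma> \<phi> \<gamma>) \<longrightarrow>
        fres B \<phi> (\<gamma>, a) b \<notin> fib B (face_cod \<psi>) (res \<Gamma> \<phi> \<gamma>, fres A \<phi> \<gamma> a)) \<longrightarrow>
        (fres A (face_comp \<phi> \<psi>) \<gamma> a, fres B (face_comp \<phi> \<psi>) (\<gamma>, a) b) = undefined)"
    using fres_in[OF assms(3), of "(\<gamma>, a)" \<phi> b] fres_in[OF assms(2), of \<gamma> \<phi> a]
      fres_comp[OF assms(3), of \<phi> \<psi> "(\<gamma>, a)" b]
    by (simp add: el_ctx_ext res_ctx_ext fres_comp[OF assms(2)])
next
  fix W \<gamma> assume "\<gamma> \<notin> el \<Gamma> W"
  then show "fib (Sigma_ty \<Gamma> A B) W \<gamma> = {}"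
    by (auto simp: fib_Sigma_ty fib_empty[OF assms(2)])
qed

text \<open>The order matters: discreteness of \<open>A\<close> first gives a preimage
  \<open>a'\<close> of the first component. Only then is the point of the extended context known to
  be the degeneracy of \<open>(\<gamma>, a')\<close>, so that discreteness of \<open>B\<close>
  applies to the second component.\<close>

lemma discrete_Sigma_ty:
  assumes "is_psh \<Gamma>" "is_ty \<Gamma> A" "discrete \<Gamma> A" "discrete (ctx_ext \<Gamma> A) B"
  shows "discrete \<Gamma> (Sigma_ty \<Gamma> A B)"
proof (rule discreteI)
  fix W i \<gamma> t
  assume i: "i \<notin> vars W" and g: "\<gamma> \<in> el \<Gamma> W"
    and t: "t \<in> fib (Sigma_ty \<Gamma> A B) (path_ext W i) (res \<Gamma> (weaken W i) \<gamma>)"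
  obtain a b where ab: "t = (a, b)" by fastforce
  obtain a' where a: "a' \<in> fib A W \<gamma>" "a = fres A (weaken W i) \<gamma> a'"
    using discreteD[OF assms(3,1) i g, of a] t by (auto simp: ab fib_Sigma_ty)
  have "b \<in> fib B (path_ext W i) (res (ctx_ext \<Gamma> A) (weaken W i) (\<gamma>, a'))"
    using t a g i by (simp add: ab fib_Sigma_ty res_ctx_ext weaken_simps)
  then obtain b' where b: "b' \<in> fib B W (\<gamma>, a')" "b = fres B (weaken W i) (\<gamma>, a') b'"
    using discreteD[OF assms(4) is_psh_ctx_ext[OF assms(1,2)] i, of "(\<gamma>, a')" b] a g
    by (auto simp: el_ctx_ext)
  show "\<exists>t'\<in>fib (Sigma_ty \<Gamma> A B) W \<gamma>. t = fres (Sigma_ty \<Gamma> A B) (weaken W i) \<gamma> t'"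
    by (rule bexI[of _ "(a', b')"]) (use a b i in \<open>simp_all add: ab fib_Sigma_ty fres_Sigma_ty weaken_simps\<close>)
qed

section \<open>Pairing and projections\<close>

lemma sub_inst_apply: "\<gamma> \<in> el \<Gamma> W \<Longrightarrow> sub_inst \<Gamma> a W \<gamma> = (\<gamma>, a W \<gamma>)"
  by (simp add: sub_inst_def sub_ext_def sub_id_def)

lemma is_tm_pair_tm:
  assumes "is_psh \<Gamma>" "is_tm \<Gamma> A a" "is_tm \<Gamma> (ty_sub \<Gamma> (sub_inst \<Gamma> a) B) b"
  shows "is_tm \<Gamma> (Sigma_ty \<Gamma> A B) (pair_tm \<Gamma> a b)"
proof -
  have b: "b W \<gamma> \<in> fib B W (\<gamma>, a W \<gamma>)" if "\<gamma> \<in> el \<Gamma> W" for W \<gamma>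
    using tm_in[OF assms(3) that] that by (simp add: fib_ty_sub sub_inst_apply)
  show ?thesis
    by (rule is_tmI)
       (auto simp: pair_tm_def fib_Sigma_ty fres_Sigma_ty res_in[OF assms(1)] b tm_in[OF assms(2)]
          tm_res[OF assms(2)] tm_res[OF assms(3)] fres_ty_sub sub_inst_apply)
qed

lemma fst_pair_tm: "is_tm \<Gamma> A a \<Longrightarrow> fst_tm \<Gamma> (pair_tm \<Gamma> a b) = a"
  by (auto intro!: ext simp: fst_tm_def pair_tm_def restrict_def tm_undefined)

lemma snd_pair_tm: "is_tm \<Gamma> B b \<Longrightarrow> snd_tm \<Gamma> (pair_tm \<Gamma> a b) = b"
  by (auto intro!: ext simp: snd_tm_def pair_tm_def restrict_def tm_undefined)

lemma pair_fst_snd_tm: "is_tm \<Gamma> S p \<Longrightarrow> pair_tm \<Gamma> (fst_tm \<Gamma> p) (snd_tm \<Gamma> p) = p"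
  by (auto intro!: ext simp: snd_tm_def fst_tm_def pair_tm_def restrict_def tm_undefined)

lemma
  assumes "is_psh \<Gamma>" "is_tm \<Gamma> (Sigma_ty \<Gamma> A B) p"
  shows is_tm_fst_tm: "is_tm \<Gamma> A (fst_tm \<Gamma> p)"
    and is_tm_snd_tm: "is_tm \<Gamma> (ty_sub \<Gamma> (sub_inst \<Gamma> (fst_tm \<Gamma> p)) B) (snd_tm \<Gamma> p)"
proof -
  have p: "fst (p W \<gamma>) \<in> fib A W \<gamma>" "snd (p W \<gamma>) \<in> fib B W (\<gamma>, fst (p W \<gamma>))"
    if "\<gamma> \<in> el \<Gamma> W" for W \<gamma>
    using tm_in[OF assms(2) that] by (cases "p W \<gamma>"; simp add: fib_Sigma_ty)+
  have r: "p (face_dom \<phi>) (res \<Gamma> \<phi> \<gamma>) = (fres A \<phi> \<gamma> (fst (p (face_cod \<phi>) \<gamma>)),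
      fres B \<phi> (\<gamma>, fst (p (face_cod \<phi>) \<gamma>)) (snd (p (face_cod \<phi>) \<gamma>)))"
    if "\<gamma> \<in> el \<Gamma> (face_cod \<phi>)" for \<phi> \<gamma>
    using tm_res[OF assms(2) that] p[OF that]
    by (cases "p (face_cod \<phi>) \<gamma>") (simp add: fres_Sigma_ty)
  show "is_tm \<Gamma> A (fst_tm \<Gamma> p)"
    by (rule is_tmI) (auto simp: fst_tm_def p r res_in[OF assms(1)])
  show "is_tm \<Gamma> (ty_sub \<Gamma> (sub_inst \<Gamma> (fst_tm \<Gamma> p)) B) (snd_tm \<Gamma> p)"
    by (rule is_tmI)
       (auto simp: snd_tm_def fst_tm_def p r res_in[OF assms(1)] fib_ty_sub fres_ty_sub sub_inst_apply)
qed

lemma ty_sub_Sigma_ty: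
  "ty_sub \<Delta> \<sigma> (Sigma_ty \<Gamma> A B) =
    Sigma_ty \<Delta> (ty_sub \<Delta> \<sigma> A) (ty_sub (ctx_ext \<Delta> (ty_sub \<Delta> \<sigma> A)) (sub_lift \<Delta> \<sigma> A) B)"
  by (rule ty_eqI)
     (auto simp: fib_ty_sub fres_ty_sub fib_Sigma_ty fres_Sigma_ty el_ctx_ext sub_lift_apply
        split: if_splits)

lemma tm_sub_pair_tm:
  "is_sub \<Delta> \<Gamma> \<sigma> \<Longrightarrow>
    tm_sub \<Delta> \<sigma> (pair_tm \<Gamma> a b) = pair_tm \<Delta> (tm_sub \<Delta> \<sigma> a) (tm_sub \<Delta> \<sigma> b)"
  by (auto intro!: ext simp: tm_sub_def pair_tm_def restrict_def sub_in)

lemma tm_sub_fst_tm: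
  "is_sub \<Delta> \<Gamma> \<sigma> \<Longrightarrow> tm_sub \<Delta> \<sigma> (fst_tm \<Gamma> p) = fst_tm \<Delta> (tm_sub \<Delta> \<sigma> p)"
  by (auto intro!: ext simp: tm_sub_def fst_tm_def restrict_def sub_in)

lemma tm_sub_snd_tm:
  "is_sub \<Delta> \<Gamma> \<sigma> \<Longrightarrow> tm_sub \<Delta> \<sigma> (snd_tm \<Gamma> p) = snd_tm \<Delta> (tm_sub \<Delta> \<sigma> p)"
  by (auto intro!: ext simp: tm_sub_def snd_tm_def restrict_def sub_in)

section \<open>Identity types\<close>

lemma fib_Id_ty: "t \<in> fib (Id_ty \<Gamma> A a b) W \<gamma> \<longleftrightarrow> \<gamma> \<in> el \<Gamma> W \<and> a W \<gamma> = b W \<gamma>"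
  by (auto simp: Id_ty_def)

lemma is_ty_Id_ty:
  assumes "is_psh \<Gamma>" "is_tm \<Gamma> A a" "is_tm \<Gamma> A b"
  shows "is_ty \<Gamma> (Id_ty \<Gamma> A a b)"
  by (rule is_tyI)
     (auto simp: set_eq_iff fib_Id_ty res_in[OF assms(1)] tm_res[OF assms(2)] tm_res[OF assms(3)])

text \<open>Restriction along the weakening is injective on elements, having a retraction, so that
  \<open>a\<close> and \<open>b\<close> agree at \<open>\<gamma>\<close> as soon as they agree at its degeneracy.\<close>

lemma discrete_Id_ty:
  assumes "is_psh \<Gamma>" "is_tm \<Gamma> A a" "is_tm \<Gamma> A b"
  shows "discrete \<Gamma> (Id_ty \<Gamma> A a b)"
proof (rule discreteI)
  fix W i \<gamma> t
  assume i: "i \<notin> vars W" and g: "\<gamma> \<in> el \<Gamma> W"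
    and t: "t \<in> fib (Id_ty \<Gamma> A a b) (path_ext W i) (res \<Gamma> (weaken W i) \<gamma>)"
  let ?w = "weaken W i" and ?s = "path_inst W i Zero"
  have "res \<Gamma> ?w \<gamma> \<in> el \<Gamma> (path_ext W i)"
    using res_in[OF assms(1), of \<gamma> ?w] i g by (simp add: weaken_simps)
  moreover have "res \<Gamma> ?s (res \<Gamma> ?w \<gamma>) = \<gamma>"
    using res_comp[OF assms(1), of ?w ?s \<gamma>] i g
    by (simp add: weaken_simps path_inst_simps weaken_path_inst res_id[OF assms(1)])
  ultimately have "c W \<gamma> = fres A ?s (res \<Gamma> ?w \<gamma>) (c (path_ext W i) (res \<Gamma> ?w \<gamma>))"
    if "is_tm \<Gamma> A c" for c
    using tm_res[OF that, of "res \<Gamma> ?w \<gamma>" ?s] i by (simp add: path_inst_simps)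
  from this[OF assms(2)] this[OF assms(3)] have "a W \<gamma> = b W \<gamma>" using t by (simp add: fib_Id_ty)
  then show "\<exists>t'\<in>fib (Id_ty \<Gamma> A a b) W \<gamma>. t = fres (Id_ty \<Gamma> A a b) ?w \<gamma> t'"
    using g by (auto simp: fib_Id_ty)
qed

lemma is_tm_refl_tm: "is_tm \<Gamma> (Id_ty \<Gamma> A a a) (refl_tm \<Gamma> a)"
  by (rule is_tmI) (auto simp: fib_Id_ty)

text \<open>A term of the identity type provides an element of each fibre, and a fibre is inhabited
  only where \<open>a\<close> and \<open>b\<close> agree. Outside the context both are
  \<open>undefined\<close>.\<close>

lemma Id_ty_reflection:
  assumes "is_tm \<Gamma> A a" "is_tm \<Gamma> A b" "is_tm \<Gamma> (Id_ty \<Gamma> A a b) e"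
  shows "a = b"
proof (intro ext)
  fix W \<gamma> show "a W \<gamma> = b W \<gamma>"
    using tm_in[OF assms(3), of \<gamma> W] tm_undefined[OF assms(1), of \<gamma> W]
      tm_undefined[OF assms(2), of \<gamma> W]
    by (cases "\<gamma> \<in> el \<Gamma> W") (auto simp: fib_Id_ty)
qed

text \<open>By equality reflection \<open>b\<close> is \<open>a\<close>, and \<open>e\<close> is
  reflexivity because \<open>unit\<close> has one element. The two instances of the motive are
  therefore literally the same type, and \<open>c\<close> inhabits it already.\<close>

lemma is_tm_J_tm:
  assumes "is_tm \<Gamma> A a" "is_tm \<Gamma> A b" "is_tm \<Gamma> (Id_ty \<Gamma> A a b) e"
    and "is_tm \<Gamma> (ty_sub \<Gamma> (Id_inst \<Gamma> a (refl_tm \<Gamma> a)) C) c"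
  shows "is_tm \<Gamma> (ty_sub \<Gamma> (Id_inst \<Gamma> b e) C) (J_tm a b C e c)"
proof -
  have "a = b" using Id_ty_reflection[OF assms(1-3)] .
  moreover have "e = refl_tm \<Gamma> a" by (intro ext) simp
  ultimately show ?thesis using assms(4) by (simp add: J_tm_def)
qed

lemma ty_sub_Id_ty:
  assumes "is_sub \<Delta> \<Gamma> \<sigma>"
  shows "ty_sub \<Delta> \<sigma> (Id_ty \<Gamma> A a b) =
    Id_ty \<Delta> (ty_sub \<Delta> \<sigma> A) (tm_sub \<Delta> \<sigma> a) (tm_sub \<Delta> \<sigma> b)"
  by (rule ty_eqI) (auto simp: set_eq_iff fib_ty_sub fib_Id_ty tm_sub_def sub_in[OF assms])

lemma tm_sub_refl_tm: "tm_sub \<Delta> \<sigma> (refl_tm \<Gamma> a) = refl_tm \<Delta> (tm_sub \<Delta> \<sigma> a)"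
  by (intro ext) simp

section \<open>Dependent products\<close>

lemma el_yoneda: "\<phi> \<in> el (yoneda W) V \<longleftrightarrow> face_dom \<phi> = V \<and> face_cod \<phi> = W"
  by (simp add: yoneda_def)

lemma res_yoneda:
  "res (yoneda W) \<psi> \<phi> =
     (if face_dom \<phi> = face_cod \<psi> \<and> face_cod \<phi> = W then face_comp \<phi> \<psi> else undefined)"
  by (simp add: yoneda_def)

lemma el_yoneda_ext:
  "(\<phi>, a) \<in> el (yoneda_ext \<Gamma> A W \<gamma>) V \<longleftrightarrow>
     face_dom \<phi> = V \<and> face_cod \<phi> = W \<and> a \<in> fib A V (res \<Gamma> \<phi> \<gamma>)"
  by (auto simp: yoneda_ext_def el_ctx_ext fib_ty_sub yoneda_sub_def el_yoneda)

lemma res_yoneda_ext: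
  "(\<phi>, a) \<in> el (yoneda_ext \<Gamma> A W \<gamma>) (face_cod \<psi>) \<Longrightarrow>
     res (yoneda_ext \<Gamma> A W \<gamma>) \<psi> (\<phi>, a) = (face_comp \<phi> \<psi>, fres A \<psi> (res \<Gamma> \<phi> \<gamma>) a)"
  unfolding el_yoneda_ext
  by (simp add: yoneda_ext_def res_ctx_ext res_yoneda fib_ty_sub fres_ty_sub yoneda_sub_def el_yoneda)

lemma yoneda_lift_apply:
  "(\<phi>, a) \<in> el (yoneda_ext \<Gamma> A W \<gamma>) V \<Longrightarrow> yoneda_lift \<Gamma> A W \<gamma> V (\<phi>, a) = (res \<Gamma> \<phi> \<gamma>, a)"
  unfolding el_yoneda_ext by (simp add: yoneda_lift_def sub_lift_apply yoneda_sub_def el_yoneda)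

lemma fib_Pi_ty:
  "f \<in> fib (Pi_ty \<Gamma> A B) W \<gamma> \<longleftrightarrow> \<gamma> \<in> el \<Gamma> W \<and>
     is_tm (yoneda_ext \<Gamma> A W \<gamma>) (ty_sub (yoneda_ext \<Gamma> A W \<gamma>) (yoneda_lift \<Gamma> A W \<gamma>) B) f"
  by (simp add: Pi_ty_def Let_def)

text \<open>This removes \<open>yoneda_ext\<close> and \<open>yoneda_lift\<close> from view: an
  element over \<gamma> is treated as a family of values at pairs of a face map \<phi> into
  \<open>W\<close> and an element of \<open>A\<close> over the restriction of \<gamma> along \<phi>.
  \<open>Pi_ty_res\<close> is its naturality in the pair.\<close>

lemma
  assumes "f \<in> fib (Pi_ty \<Gamma> A B) W \<gamma>"
  shows Pi_ty_base: "\<gamma> \<in> el \<Gamma> W"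
    and Pi_ty_in: "face_cod \<phi> = W \<Longrightarrow> a \<in> fib A (face_dom \<phi>) (res \<Gamma> \<phi> \<gamma>) \<Longrightarrow>
      f (face_dom \<phi>) (\<phi>, a) \<in> fib B (face_dom \<phi>) (res \<Gamma> \<phi> \<gamma>, a)"
    and Pi_ty_undefined: "\<not> (face_dom \<phi> = V \<and> face_cod \<phi> = W \<and> a \<in> fib A V (res \<Gamma> \<phi> \<gamma>)) \<Longrightarrow>
      f V (\<phi>, a) = undefined"
    and Pi_ty_res: "face_cod \<phi> = W \<Longrightarrow> face_dom \<phi> = face_cod \<psi> \<Longrightarrow>
      a \<in> fib A (face_cod \<psi>) (res \<Gamma> \<phi> \<gamma>) \<Longrightarrow>
      f (face_dom \<psi>) (face_comp \<phi> \<psi>, fres A \<psi> (res \<Gamma> \<phi> \<gamma>) a) =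
        fres B \<psi> (res \<Gamma> \<phi> \<gamma>, a) (f (face_cod \<psi>) (\<phi>, a))"
proof -
  have f: "is_tm (yoneda_ext \<Gamma> A W \<gamma>) (ty_sub (yoneda_ext \<Gamma> A W \<gamma>) (yoneda_lift \<Gamma> A W \<gamma>) B) f"
    and "\<gamma> \<in> el \<Gamma> W" using assms by (simp_all add: fib_Pi_ty)
  then show "\<gamma> \<in> el \<Gamma> W" by simp
  show "f (face_dom \<phi>) (\<phi>, a) \<in> fib B (face_dom \<phi>) (res \<Gamma> \<phi> \<gamma>, a)"
    if "face_cod \<phi> = W" "a \<in> fib A (face_dom \<phi>) (res \<Gamma> \<phi> \<gamma>)"
    using tm_in[OF f, of "(\<phi>, a)" "face_dom \<phi>"] that
    by (simp add: el_yoneda_ext fib_ty_sub yoneda_lift_apply)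
  show "f V (\<phi>, a) = undefined"
    if "\<not> (face_dom \<phi> = V \<and> face_cod \<phi> = W \<and> a \<in> fib A V (res \<Gamma> \<phi> \<gamma>))"
    using tm_undefined[OF f, of "(\<phi>, a)" V] that by (simp add: el_yoneda_ext)
  show "f (face_dom \<psi>) (face_comp \<phi> \<psi>, fres A \<psi> (res \<Gamma> \<phi> \<gamma>) a) =
        fres B \<psi> (res \<Gamma> \<phi> \<gamma>, a) (f (face_cod \<psi>) (\<phi>, a))"
    if "face_cod \<phi> = W" "face_dom \<phi> = face_cod \<psi>" "a \<in> fib A (face_cod \<psi>) (res \<Gamma> \<phi> \<gamma>)"
    using tm_res[OF f, of "(\<phi>, a)" \<psi>] that
    by (simp add: el_yoneda_ext fres_ty_sub yoneda_lift_apply res_yoneda_ext)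
qed

lemma fib_Pi_tyI:
  assumes "\<gamma> \<in> el \<Gamma> W"
    and "\<And>\<phi> a. face_cod \<phi> = W \<Longrightarrow> a \<in> fib A (face_dom \<phi>) (res \<Gamma> \<phi> \<gamma>) \<Longrightarrow>
      f (face_dom \<phi>) (\<phi>, a) \<in> fib B (face_dom \<phi>) (res \<Gamma> \<phi> \<gamma>, a)"
    and "\<And>\<phi> V a. \<not> (face_dom \<phi> = V \<and> face_cod \<phi> = W \<and> a \<in> fib A V (res \<Gamma> \<phi> \<gamma>)) \<Longrightarrow>
      f V (\<phi>, a) = undefined"
    and "\<And>\<phi> \<psi> a. face_cod \<phi> = W \<Longrightarrow> face_dom \<phi> = face_cod \<psi> \<Longrightarrow>
      a \<in> fib A (face_cod \<psi>) (res \<Gamma> \<phi> \<gamma>) \<Longrightarrow>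
      f (face_dom \<psi>) (face_comp \<phi> \<psi>, fres A \<psi> (res \<Gamma> \<phi> \<gamma>) a) =
        fres B \<psi> (res \<Gamma> \<phi> \<gamma>, a) (f (face_cod \<psi>) (\<phi>, a))"
  shows "f \<in> fib (Pi_ty \<Gamma> A B) W \<gamma>"
  unfolding fib_Pi_ty
proof (intro conjI assms(1) is_tmI)
  fix V x assume "x \<in> el (yoneda_ext \<Gamma> A W \<gamma>) V"
  then show "f V x \<in> fib (ty_sub (yoneda_ext \<Gamma> A W \<gamma>) (yoneda_lift \<Gamma> A W \<gamma>) B) V x"
    using assms(2) by (cases x) (auto simp: fib_ty_sub yoneda_lift_apply el_yoneda_ext)
next
  fix V x assume "x \<notin> el (yoneda_ext \<Gamma> A W \<gamma>) V"
  then show "f V x = undefined" using assms(3) by (cases x) (auto simp: el_yoneda_ext)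
next
  fix \<psi> x assume "x \<in> el (yoneda_ext \<Gamma> A W \<gamma>) (face_cod \<psi>)"
  then show "f (face_dom \<psi>) (res (yoneda_ext \<Gamma> A W \<gamma>) \<psi> x) =
      fres (ty_sub (yoneda_ext \<Gamma> A W \<gamma>) (yoneda_lift \<Gamma> A W \<gamma>) B) \<psi> x (f (face_cod \<psi>) x)"
    using assms(4)
    by (cases x) (auto simp: fres_ty_sub res_yoneda_ext yoneda_lift_apply el_yoneda_ext)
qed

text \<open>The lift of \<phi> sends \<open>(\<psi>, a)\<close> to
  \<open>(face_comp \<phi> \<psi>, a)\<close>. The component \<open>a\<close> can stay unchanged
  because restricting \<gamma> along the composite equals restricting it in two steps.\<close>

lemma fres_Pi_ty:
  assumes "is_psh \<Gamma>" "f \<in> fib (Pi_ty \<Gamma> A B) (face_cod \<phi>) \<gamma>"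
  shows "fres (Pi_ty \<Gamma> A B) \<phi> \<gamma> f V (\<psi>, a) =
    (if face_dom \<psi> = V \<and> face_cod \<psi> = face_dom \<phi> \<and> a \<in> fib A V (res \<Gamma> \<psi> (res \<Gamma> \<phi> \<gamma>))
     then f V (face_comp \<phi> \<psi>, a) else undefined)"
proof -
  let ?X = "yoneda_ext \<Gamma> A (face_dom \<phi>) (res \<Gamma> \<phi> \<gamma>)"
  let ?s = "sub_lift (yoneda (face_dom \<phi>)) (yoneda_sub (yoneda (face_cod \<phi>)) (face_dom \<phi>) \<phi>)
    (ty_sub (yoneda (face_cod \<phi>)) (yoneda_sub \<Gamma> (face_cod \<phi>) \<gamma>) A)"
  have f: "f \<in> fib (Pi_ty \<Gamma> A B) (face_cod \<phi>) \<gamma> \<Longrightarrow> fres (Pi_ty \<Gamma> A B) \<phi> \<gamma> f = tm_sub ?X ?s f"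
    by (simp add: Pi_ty_def Let_def)
  have s: "?s V (\<psi>, a) = (face_comp \<phi> \<psi>, a)" if "(\<psi>, a) \<in> el ?X V"
    using that res_comp[OF assms(1), of \<phi> \<psi> \<gamma>] Pi_ty_base[OF assms(2)]
    by (auto simp: sub_lift_apply el_yoneda_ext el_yoneda yoneda_sub_def fib_ty_sub res_yoneda)
  show ?thesis
    using f[OF assms(2)] s by (auto simp: tm_sub_def el_yoneda_ext)
qed

lemma fres_Pi_ty_undefined:
  "f \<notin> fib (Pi_ty \<Gamma> A B) (face_cod \<phi>) \<gamma> \<Longrightarrow> fres (Pi_ty \<Gamma> A B) \<phi> \<gamma> f = undefined"
  by (simp add: Pi_ty_def Let_def)

lemma fres_Pi_ty_in:
  assumes "is_psh \<Gamma>" "is_ty \<Gamma> A" "f \<in> fib (Pi_ty \<Gamma> A B) (face_cod \<phi>) \<gamma>"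
  shows "fres (Pi_ty \<Gamma> A B) \<phi> \<gamma> f \<in> fib (Pi_ty \<Gamma> A B) (face_dom \<phi>) (res \<Gamma> \<phi> \<gamma>)"
proof -
  note g = Pi_ty_base[OF assms(3)]
  note g' = res_in[OF assms(1) g]
  show ?thesis
  proof (rule fib_Pi_tyI)
    show "res \<Gamma> \<phi> \<gamma> \<in> el \<Gamma> (face_dom \<phi>)" by (fact g')
  next
    fix \<psi> a assume "face_cod \<psi> = face_dom \<phi>" "a \<in> fib A (face_dom \<psi>) (res \<Gamma> \<psi> (res \<Gamma> \<phi> \<gamma>))"
    then show "fres (Pi_ty \<Gamma> A B) \<phi> \<gamma> f (face_dom \<psi>) (\<psi>, a)
        \<in> fib B (face_dom \<psi>) (res \<Gamma> \<psi> (res \<Gamma> \<phi> \<gamma>), a)"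
      using Pi_ty_in[OF assms(3), of "face_comp \<phi> \<psi>" a]
      by (simp add: fres_Pi_ty[OF assms(1,3)] res_comp[OF assms(1) _ g])
  next
    fix \<psi> V a
    assume "\<not> (face_dom \<psi> = V \<and> face_cod \<psi> = face_dom \<phi> \<and> a \<in> fib A V (res \<Gamma> \<psi> (res \<Gamma> \<phi> \<gamma>)))"
    then show "fres (Pi_ty \<Gamma> A B) \<phi> \<gamma> f V (\<psi>, a) = undefined"
      by (simp only: fres_Pi_ty[OF assms(1,3)] if_False)
  next
    fix \<psi> \<chi> a
    assume h: "face_cod \<psi> = face_dom \<phi>" "face_dom \<psi> = face_cod \<chi>"
      "a \<in> fib A (face_cod \<chi>) (res \<Gamma> \<psi> (res \<Gamma> \<phi> \<gamma>))"
    have e: "res \<Gamma> \<psi> (res \<Gamma> \<phi> \<gamma>) \<in> el \<Gamma> (face_cod \<chi>)"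
      using res_in[OF assms(1), of "res \<Gamma> \<phi> \<gamma>" \<psi>] g' h by simp
    \<comment> \<open>This membership satisfies the guard of \<open>fres_Pi_ty\<close> at the
      composite of \<psi> and \<chi>; without it the left-hand side would evaluate to
      \<open>undefined\<close>.\<close>
    then have "fres A \<chi> (res \<Gamma> \<psi> (res \<Gamma> \<phi> \<gamma>)) a
        \<in> fib A (face_dom \<chi>) (res \<Gamma> (face_comp \<psi> \<chi>) (res \<Gamma> \<phi> \<gamma>))"
      using fres_in[OF assms(2) e h(3)] h g' by (simp add: res_comp[OF assms(1)])
    then show "fres (Pi_ty \<Gamma> A B) \<phi> \<gamma> f (face_dom \<chi>)
          (face_comp \<psi> \<chi>, fres A \<chi> (res \<Gamma> \<psi> (res \<Gamma> \<phi> \<gamma>)) a) =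
        fres B \<chi> (res \<Gamma> \<psi> (res \<Gamma> \<phi> \<gamma>), a) (fres (Pi_ty \<Gamma> A B) \<phi> \<gamma> f (face_cod \<chi>) (\<psi>, a))"
      using Pi_ty_res[OF assms(3), of "face_comp \<phi> \<psi>" \<chi> a] h
      by (simp add: fres_Pi_ty[OF assms(1,3)] res_comp[OF assms(1) _ g] face_comp_assoc)
  qed
qed

lemma is_ty_Pi_ty:
  assumes "is_psh \<Gamma>" "is_ty \<Gamma> A"
  shows "is_ty \<Gamma> (Pi_ty \<Gamma> A B)"
proof (rule is_tyI)
  fix \<phi> \<gamma> f assume "f \<in> fib (Pi_ty \<Gamma> A B) (face_cod \<phi>) \<gamma>"
  then show "fres (Pi_ty \<Gamma> A B) \<phi> \<gamma> f \<in> fib (Pi_ty \<Gamma> A B) (face_dom \<phi>) (res \<Gamma> \<phi> \<gamma>)"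
    by (rule fres_Pi_ty_in[OF assms])
next
  fix W \<gamma> f assume g: "\<gamma> \<in> el \<Gamma> W" and f: "f \<in> fib (Pi_ty \<Gamma> A B) W \<gamma>"
  then have "fres (Pi_ty \<Gamma> A B) (face_id W) \<gamma> f V (\<psi>, a) = f V (\<psi>, a)" for V \<psi> a
    using fres_Pi_ty[OF assms(1), of f A B "face_id W" \<gamma> V \<psi> a] Pi_ty_undefined[OF f, of \<psi> V a]
    by (auto simp: res_id[OF assms(1)])
  then show "fres (Pi_ty \<Gamma> A B) (face_id W) \<gamma> f = f" by (intro ext) (simp add: split_paired_all)
next
  fix \<phi> \<psi> \<gamma> f
  assume h: "face_dom \<phi> = face_cod \<psi>" and g: "\<gamma> \<in> el \<Gamma> (face_cod \<phi>)"
    and f: "f \<in> fib (Pi_ty \<Gamma> A B) (face_cod \<phi>) \<gamma>"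
  have f': "fres (Pi_ty \<Gamma> A B) \<phi> \<gamma> f \<in> fib (Pi_ty \<Gamma> A B) (face_cod \<psi>) (res \<Gamma> \<phi> \<gamma>)"
    using fres_Pi_ty_in[OF assms f] h by simp
  have g': "res \<Gamma> \<phi> \<gamma> \<in> el \<Gamma> (face_cod \<psi>)" using res_in[OF assms(1) g] h by simp
  have "fres (Pi_ty \<Gamma> A B) (face_comp \<phi> \<psi>) \<gamma> f V (\<chi>, a) =
      fres (Pi_ty \<Gamma> A B) \<psi> (res \<Gamma> \<phi> \<gamma>) (fres (Pi_ty \<Gamma> A B) \<phi> \<gamma> f) V (\<chi>, a)" for V \<chi> a
    using fres_Pi_ty[OF assms(1), of f A B "face_comp \<phi> \<psi>" \<gamma> V \<chi> a] f h
    by (auto simp: fres_Pi_ty[OF assms(1) f'] fres_Pi_ty[OF assms(1) f] face_comp_assoc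
        res_comp[OF assms(1) _ g] res_comp[OF assms(1) _ g'])
  then show "fres (Pi_ty \<Gamma> A B) (face_comp \<phi> \<psi>) \<gamma> f =
      fres (Pi_ty \<Gamma> A B) \<psi> (res \<Gamma> \<phi> \<gamma>) (fres (Pi_ty \<Gamma> A B) \<phi> \<gamma> f)"
    by (intro ext) (simp add: split_paired_all)
qed (auto simp: fib_Pi_ty fres_Pi_ty_undefined)

lemma discrete_Pi_ty:
  assumes "is_psh \<Gamma>" "is_ty \<Gamma> A" "is_ty (ctx_ext \<Gamma> A) B" "discrete (ctx_ext \<Gamma> A) B"
  shows "discrete \<Gamma> (Pi_ty \<Gamma> A B)"
proof (rule discreteI)
  fix W i \<gamma> f
  let ?w = "weaken W i" and ?s = "path_inst W i Zero"
  assume i: "i \<notin> vars W" and g: "\<gamma> \<in> el \<Gamma> W"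
    and f: "f \<in> fib (Pi_ty \<Gamma> A B) (path_ext W i) (res \<Gamma> ?w \<gamma>)"
  note i_simps = weaken_simps[OF i] path_inst_simps[OF i, simplified]
  note EX = is_psh_ctx_ext[OF assms(1,2)]
  have sw: "res \<Gamma> ?s (res \<Gamma> ?w \<gamma>) = \<gamma>"
    using res_comp[OF assms(1), of ?w ?s \<gamma>] i g
    by (simp add: i_simps weaken_path_inst res_id[OF assms(1)])
  \<comment> \<open>Restriction along a section recovers any element from its degeneracy, so this is
    the only possible preimage of \<open>f\<close>.\<close>
  define f' where "f' = fres (Pi_ty \<Gamma> A B) ?s (res \<Gamma> ?w \<gamma>) f"
  have f': "f' \<in> fib (Pi_ty \<Gamma> A B) W \<gamma>"
    using fres_Pi_ty_in[OF assms(1,2), of f B ?s "res \<Gamma> ?w \<gamma>"] f sw i unfolding f'_def by (simp add: i_simps)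
  have f'_apply: "f' V (\<psi>, a) = f V (face_comp ?s \<psi>, a)"
    if "face_dom \<psi> = V" "face_cod \<psi> = W" "a \<in> fib A V (res \<Gamma> \<psi> \<gamma>)" for V \<psi> a
    using fres_Pi_ty[OF assms(1), of f A B ?s "res \<Gamma> ?w \<gamma>" V \<psi> a] f sw i that
    unfolding f'_def by (simp add: i_simps)
  \<comment> \<open>The degeneracy of \<open>f'\<close> evaluates \<open>f\<close> at \<phi> with
    its value at \<open>i\<close> reset to 0, so this independence of the value at \<open>i\<close>
    is what degeneracy of \<open>f\<close> amounts to.\<close>
  have key: "f V (\<phi>, a) = f V (face_comp ?s (face_comp ?w \<phi>), a)"
    if \<phi>: "face_dom \<phi> = V" "face_cod \<phi> = path_ext W i" and a: "a \<in> fib A V (res \<Gamma> \<phi> (res \<Gamma> ?w \<gamma>))"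
    for V \<phi> a
  proof -
    obtain j where j: "j \<notin> vars V" using finite_vars[of V] ex_new_if_finite infinite_UNIV_nat by blast
    define \<gamma>' where "\<gamma>' = res \<Gamma> \<phi> (res \<Gamma> ?w \<gamma>)"
    have g': "\<gamma>' = res \<Gamma> (face_comp ?w \<phi>) \<gamma>" "\<gamma>' \<in> el \<Gamma> V"
      using res_comp[OF assms(1), of ?w \<phi> \<gamma>] res_in[OF assms(1), of \<gamma> "face_comp ?w \<phi>"] g \<phi>
      by (auto simp: i_simps \<gamma>'_def)
    let ?c = "path_cylinder \<phi> i j" and ?v = "weaken V j"
    have j': "j \<notin> vars (face_dom \<phi>)" using j \<phi> by simp
    note c_simps = path_cylinder_simps[OF \<phi>(2) i j', unfolded \<phi>(1)]
    note v_simps = weaken_simps[OF j]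
    \<comment> \<open>The cylinder changes \<phi> only at \<open>i\<close>, which \<open>?w\<close>
      forgets. The base point of the cylinder is therefore the degeneracy in \<open>j\<close> of the
      base point \<gamma>' of \<phi>.\<close>
    have gc: "res \<Gamma> ?c (res \<Gamma> ?w \<gamma>) = res \<Gamma> ?v \<gamma>'"
    proof -
      have "res \<Gamma> ?c (res \<Gamma> ?w \<gamma>) = res \<Gamma> (face_comp ?w ?c) \<gamma>"
        using res_comp[OF assms(1), of ?w ?c \<gamma>] g by (simp add: i_simps c_simps)
      also have "face_comp ?w ?c = face_comp (face_comp ?w \<phi>) ?v"
        using weaken_path_cylinder[OF \<phi>(2) i j'] \<phi>(1) by simp
      also have "res \<Gamma> \<dots> \<gamma> = res \<Gamma> ?v \<gamma>'"
        using res_comp[OF assms(1), of "face_comp ?w \<phi>" ?v \<gamma>] g \<phi>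
        by (simp add: i_simps v_simps g'(1))
      finally show ?thesis .
    qed
    \<comment> \<open>Extending \<open>a\<close> constantly along \<open>j\<close> makes the whole
      argument the degeneracy of \<open>(\<gamma>', a)\<close>, so discreteness of \<open>B\<close>
      applies to the value of \<open>f\<close> on the cylinder.\<close>
    define a1 where "a1 = fres A ?v \<gamma>' a"
    have aV: "a \<in> fib A V \<gamma>'" using a by (simp add: \<gamma>'_def)
    have a1: "a1 \<in> fib A (path_ext V j) (res \<Gamma> ?v \<gamma>')"
      using fres_in[OF assms(2), of \<gamma>' ?v a] aV g' by (simp add: a1_def v_simps)
    have x: "(\<gamma>', a) \<in> el (ctx_ext \<Gamma> A) V" using g' aV by (simp add: el_ctx_ext)
    have rx: "res (ctx_ext \<Gamma> A) ?v (\<gamma>', a) = (res \<Gamma> ?v \<gamma>', a1)"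
      using g' aV by (simp add: res_ctx_ext v_simps a1_def)
    have "f (path_ext V j) (?c, a1) \<in> fib B (path_ext V j) (res (ctx_ext \<Gamma> A) ?v (\<gamma>', a))"
      using Pi_ty_in[OF f, of ?c a1] a1 by (simp add: c_simps gc rx)
    then obtain b where b: "b \<in> fib B V (\<gamma>', a)"
      "f (path_ext V j) (?c, a1) = fres B ?v (\<gamma>', a) b"
      using discreteD[OF assms(4) EX j x] by blast
    \<comment> \<open>Instantiating \<open>j\<close> cancels the weakening by \<open>j\<close> both
      in \<open>A\<close> and in \<open>B\<close>. By naturality of \<open>f\<close>, every instance
      of the cylinder thus yields the same \<open>b\<close>, whatever \<open>r\<close> is.\<close>
    have inst: "f V (face_comp ?c (path_inst V j r), a) = b"
      if r: "r \<in> {Zero, One} \<union> Var ` vars V" for r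
    proof -
      let ?r = "path_inst V j r"
      note r_simps = path_inst_simps[OF j r]
      have vr: "face_comp ?v ?r = face_id V" by (rule weaken_path_inst[OF j r])
      have "fres A ?r (res \<Gamma> ?v \<gamma>') a1 = a"
        using fres_comp[OF assms(2), of ?v ?r \<gamma>' a] g' aV
        by (simp add: v_simps r_simps vr fres_id[OF assms(2)] a1_def)
      then have "f V (face_comp ?c ?r, a) = fres B ?r (res \<Gamma> ?v \<gamma>', a1) (fres B ?v (\<gamma>', a) b)"
        using Pi_ty_res[OF f, of ?c ?r a1] a1 by (simp add: c_simps r_simps gc b(2))
      also have "\<dots> = b"
        using fres_comp[OF assms(3), of ?v ?r "(\<gamma>', a)" b] x b(1)
        by (simp add: v_simps r_simps vr fres_id[OF assms(3)] rx)
      finally show ?thesis .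
    qed
    have "i \<in> vars (face_cod \<phi>)" using \<phi> i by (simp add: vars_path_ext)
    then have "face_map \<phi> i \<in> {Zero, One} \<union> Var ` vars V"
      using \<phi>(1) by (cases rule: face_map_cases) auto
    \<comment> \<open>Taking for \<open>r\<close> the value of \<phi> at \<open>i\<close> gives back
      \<phi>, and taking \<open>Zero\<close> gives the face map that factors through the section;
      both values of \<open>f\<close> are \<open>b\<close>.\<close>
    from inst[OF this] inst[of Zero] show ?thesis
      using path_cylinder_inst_self[OF \<phi>(2) i j'] path_cylinder_inst_Zero[OF \<phi>(2) i j'] \<phi>(1)
      by simp
  qed
  have "f V (\<phi>, a) = fres (Pi_ty \<Gamma> A B) ?w \<gamma> f' V (\<phi>, a)" for V \<phi> a
  proof (cases "face_dom \<phi> = V \<and> face_cod \<phi> = path_ext W i \<and> a \<in> fib A V (res \<Gamma> \<phi> (res \<Gamma> ?w \<gamma>))")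
    case True
    then have "fres (Pi_ty \<Gamma> A B) ?w \<gamma> f' V (\<phi>, a) = f' V (face_comp ?w \<phi>, a)"
      using fres_Pi_ty[OF assms(1), of f' A B ?w \<gamma>] f' by (simp add: i_simps)
    also have "\<dots> = f V (face_comp ?s (face_comp ?w \<phi>), a)"
      using True res_comp[OF assms(1), of ?w \<phi> \<gamma>] g by (intro f'_apply) (simp_all add: i_simps)
    finally show ?thesis using key True by simp
  next
    case False
    then have "fres (Pi_ty \<Gamma> A B) ?w \<gamma> f' V (\<phi>, a) = undefined"
      using fres_Pi_ty[OF assms(1), of f' A B ?w \<gamma> V \<phi> a] f' by (auto simp: i_simps)
    then show ?thesis using Pi_ty_undefined[OF f, of \<phi> V a] False by simp
  qed
  then have "f = fres (Pi_ty \<Gamma> A B) ?w \<gamma> f'" by (intro ext) (simp add: split_paired_all)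
  with f' show "\<exists>f'\<in>fib (Pi_ty \<Gamma> A B) W \<gamma>. f = fres (Pi_ty \<Gamma> A B) ?w \<gamma> f'" by blast
qed

section \<open>Abstraction and application\<close>

lemma lam_tm_apply:
  assumes "\<gamma> \<in> el \<Gamma> W"
  shows "lam_tm \<Gamma> A b W \<gamma> V (\<phi>, a) =
    (if face_dom \<phi> = V \<and> face_cod \<phi> = W \<and> a \<in> fib A V (res \<Gamma> \<phi> \<gamma>)
     then b V (res \<Gamma> \<phi> \<gamma>, a) else undefined)"
  using assms
  by (auto simp: lam_tm_def tm_sub_def yoneda_lift_apply el_yoneda_ext)

lemma is_tm_lam_tm:
  assumes "is_psh \<Gamma>" "is_ty \<Gamma> A" "is_tm (ctx_ext \<Gamma> A) B b"
  shows "is_tm \<Gamma> (Pi_ty \<Gamma> A B) (lam_tm \<Gamma> A b)"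
proof (rule is_tmI)
  have l: "lam_tm \<Gamma> A b W \<gamma> \<in> fib (Pi_ty \<Gamma> A B) W \<gamma>" if g: "\<gamma> \<in> el \<Gamma> W" for W \<gamma>
  proof (rule fib_Pi_tyI)
    show "\<gamma> \<in> el \<Gamma> W" by (fact g)
  next
    fix \<phi> a assume "face_cod \<phi> = W" "a \<in> fib A (face_dom \<phi>) (res \<Gamma> \<phi> \<gamma>)"
    then show "lam_tm \<Gamma> A b W \<gamma> (face_dom \<phi>) (\<phi>, a) \<in> fib B (face_dom \<phi>) (res \<Gamma> \<phi> \<gamma>, a)"
      using g res_in[OF assms(1), of \<gamma> \<phi>] tm_in[OF assms(3), of "(res \<Gamma> \<phi> \<gamma>, a)" "face_dom \<phi>"]
      by (simp add: lam_tm_apply el_ctx_ext)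
  next
    fix \<phi> V a assume "\<not> (face_dom \<phi> = V \<and> face_cod \<phi> = W \<and> a \<in> fib A V (res \<Gamma> \<phi> \<gamma>))"
    then show "lam_tm \<Gamma> A b W \<gamma> V (\<phi>, a) = undefined" using g by (simp only: lam_tm_apply if_False)
  next
    fix \<phi> \<psi> a
    assume h: "face_cod \<phi> = W" "face_dom \<phi> = face_cod \<psi>" "a \<in> fib A (face_cod \<psi>) (res \<Gamma> \<phi> \<gamma>)"
    have e: "res \<Gamma> \<phi> \<gamma> \<in> el \<Gamma> (face_cod \<psi>)" using res_in[OF assms(1), of \<gamma> \<phi>] g h by simp
    show "lam_tm \<Gamma> A b W \<gamma> (face_dom \<psi>) (face_comp \<phi> \<psi>, fres A \<psi> (res \<Gamma> \<phi> \<gamma>) a) =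
        fres B \<psi> (res \<Gamma> \<phi> \<gamma>, a) (lam_tm \<Gamma> A b W \<gamma> (face_cod \<psi>) (\<phi>, a))"
      using h g e fres_in[OF assms(2) e, of a] tm_res[OF assms(3), of "(res \<Gamma> \<phi> \<gamma>, a)" \<psi>]
      by (simp add: lam_tm_apply res_comp[OF assms(1)] el_ctx_ext res_ctx_ext)
  qed
  {
    fix W \<gamma> assume "\<gamma> \<in> el \<Gamma> W"
    then show "lam_tm \<Gamma> A b W \<gamma> \<in> fib (Pi_ty \<Gamma> A B) W \<gamma>" by (rule l)
  next
    fix W \<gamma> assume "\<gamma> \<notin> el \<Gamma> W"
    then show "lam_tm \<Gamma> A b W \<gamma> = undefined" by (simp add: lam_tm_def)
  next
    fix \<phi> \<gamma> assume g: "\<gamma> \<in> el \<Gamma> (face_cod \<phi>)"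
    have "lam_tm \<Gamma> A b (face_dom \<phi>) (res \<Gamma> \<phi> \<gamma>) V (\<psi>, a) =
        fres (Pi_ty \<Gamma> A B) \<phi> \<gamma> (lam_tm \<Gamma> A b (face_cod \<phi>) \<gamma>) V (\<psi>, a)" for V \<psi> a
      by (auto simp: lam_tm_apply[OF res_in[OF assms(1) g]] lam_tm_apply[OF g]
          fres_Pi_ty[OF assms(1) l[OF g]] res_comp[OF assms(1) _ g])
    then show "lam_tm \<Gamma> A b (face_dom \<phi>) (res \<Gamma> \<phi> \<gamma>) =
        fres (Pi_ty \<Gamma> A B) \<phi> \<gamma> (lam_tm \<Gamma> A b (face_cod \<phi>) \<gamma>)"
      by (intro ext) (simp add: split_paired_all)
  }
qed

lemma ap_lam_tm:
  assumes "is_psh \<Gamma>" "is_tm (ctx_ext \<Gamma> A) B b"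
  shows "ap_tm \<Gamma> A (lam_tm \<Gamma> A b) = b"
proof -
  have "ap_tm \<Gamma> A (lam_tm \<Gamma> A b) W (\<gamma>, a) = b W (\<gamma>, a)" for W \<gamma> a
    using tm_undefined[OF assms(2), of "(\<gamma>, a)" W]
    by (auto simp: ap_tm_def el_ctx_ext lam_tm_apply res_id[OF assms(1)])
  then show ?thesis by (intro ext) (simp add: split_paired_all)
qed

text \<open>Two naturalities combine. That of \<open>f\<close> in the context turns evaluation at
  the identity after restriction into evaluation of the original function at \<phi>; that of this
  function then moves \<phi> outside, since \<phi> is the identity composed with \<phi>.\<close>

lemma is_tm_ap_tm:
  assumes "is_psh \<Gamma>" "is_ty \<Gamma> A" "is_tm \<Gamma> (Pi_ty \<Gamma> A B) f"
  shows "is_tm (ctx_ext \<Gamma> A) B (ap_tm \<Gamma> A f)"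
proof -
  have "ap_tm \<Gamma> A f W (\<gamma>, a) \<in> fib B W (\<gamma>, a)" if "\<gamma> \<in> el \<Gamma> W" "a \<in> fib A W \<gamma>" for W \<gamma> a
    using Pi_ty_in[OF tm_in[OF assms(3) that(1)], of "face_id W" a] that
    by (simp add: ap_tm_def el_ctx_ext res_id[OF assms(1)])
  moreover have "ap_tm \<Gamma> A f (face_dom \<phi>) (res \<Gamma> \<phi> \<gamma>, fres A \<phi> \<gamma> a) =
      fres B \<phi> (\<gamma>, a) (ap_tm \<Gamma> A f (face_cod \<phi>) (\<gamma>, a))"
    if g: "\<gamma> \<in> el \<Gamma> (face_cod \<phi>)" and a: "a \<in> fib A (face_cod \<phi>) \<gamma>" for \<phi> \<gamma> a
  proof -
    note F = tm_in[OF assms(3) g]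
    have g': "res \<Gamma> \<phi> \<gamma> \<in> el \<Gamma> (face_dom \<phi>)" using res_in[OF assms(1) g] .
    have a': "fres A \<phi> \<gamma> a \<in> fib A (face_dom \<phi>) (res \<Gamma> \<phi> \<gamma>)" using fres_in[OF assms(2) g a] .
    have "ap_tm \<Gamma> A f (face_dom \<phi>) (res \<Gamma> \<phi> \<gamma>, fres A \<phi> \<gamma> a) =
        fres (Pi_ty \<Gamma> A B) \<phi> \<gamma> (f (face_cod \<phi>) \<gamma>) (face_dom \<phi>) (face_id (face_dom \<phi>), fres A \<phi> \<gamma> a)"
      using g' a' by (simp add: ap_tm_def el_ctx_ext tm_res[OF assms(3) g])
    also have "\<dots> = f (face_cod \<phi>) \<gamma> (face_dom \<phi>) (\<phi>, fres A \<phi> \<gamma> a)"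
      using a' g' by (simp add: fres_Pi_ty[OF assms(1) F] res_id[OF assms(1)])
    also have "\<dots> = fres B \<phi> (\<gamma>, a) (f (face_cod \<phi>) \<gamma> (face_cod \<phi>) (face_id (face_cod \<phi>), a))"
      using Pi_ty_res[OF F, of "face_id (face_cod \<phi>)" \<phi> a] g a by (simp add: res_id[OF assms(1)])
    finally show ?thesis using g a by (simp add: ap_tm_def el_ctx_ext)
  qed
  ultimately show ?thesis
    by (intro is_tmI) (auto simp: el_ctx_ext res_ctx_ext, auto simp: ap_tm_def el_ctx_ext)
qed

text \<open>This is the Yoneda argument: by naturality of \<open>f\<close>, the value of
  \<open>f W \<gamma>\<close> at \<phi> is the value at the identity of \<open>f\<close> over the
  restriction of \<gamma> along \<phi>, and application reads off exactly these values.\<close>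

lemma lam_ap_tm:
  assumes "is_psh \<Gamma>" "is_ty \<Gamma> A" "is_tm \<Gamma> (Pi_ty \<Gamma> A B) f"
  shows "lam_tm \<Gamma> A (ap_tm \<Gamma> A f) = f"
proof (intro ext)
  fix W \<gamma> V and x :: "face \<times> 'b"
  obtain \<phi> a where x: "x = (\<phi>, a)" by fastforce
  show "lam_tm \<Gamma> A (ap_tm \<Gamma> A f) W \<gamma> V x = f W \<gamma> V x"
  proof (cases "\<gamma> \<in> el \<Gamma> W")
    case False
    then show ?thesis using tm_undefined[OF assms(3) False] by (simp add: lam_tm_def)
  next
    case g: True
    note F = tm_in[OF assms(3) g]
    show ?thesis
    proof (cases "face_dom \<phi> = V \<and> face_cod \<phi> = W \<and> a \<in> fib A V (res \<Gamma> \<phi> \<gamma>)")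
      case True
      then have g': "res \<Gamma> \<phi> \<gamma> \<in> el \<Gamma> V" using res_in[OF assms(1), of \<gamma> \<phi>] g by auto
      have "lam_tm \<Gamma> A (ap_tm \<Gamma> A f) W \<gamma> V x = f V (res \<Gamma> \<phi> \<gamma>) V (face_id V, a)"
        using True g' by (simp add: x lam_tm_apply[OF g] ap_tm_def el_ctx_ext)
      also have "f V (res \<Gamma> \<phi> \<gamma>) = fres (Pi_ty \<Gamma> A B) \<phi> \<gamma> (f W \<gamma>)"
        using tm_res[OF assms(3), of \<gamma> \<phi>] True g by auto
      also have "\<dots> V (face_id V, a) = f W \<gamma> V x"
        using True g' fres_Pi_ty[OF assms(1), of "f W \<gamma>" A B \<phi> \<gamma> V "face_id V" a] F
        by (auto simp: x res_id[OF assms(1)])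
      finally show ?thesis .
    next
      case False
      then show ?thesis using Pi_ty_undefined[OF F False] by (simp only: x lam_tm_apply[OF g] if_False)
    qed
  qed
qed

section \<open>Stability of products under substitution\<close>

lemma yoneda_ext_ty_sub:
  assumes "is_psh \<Delta>" "is_sub \<Delta> \<Gamma> \<sigma>" "\<delta> \<in> el \<Delta> W"
  shows "yoneda_ext \<Delta> (ty_sub \<Delta> \<sigma> A) W \<delta> = yoneda_ext \<Gamma> A W (\<sigma> W \<delta>)"
proof -
  \<comment> \<open>Naturality of \<sigma> identifies restricting \<delta> before applying \<sigma>
    with restricting \<open>\<sigma> W \<delta>\<close>, so both sides have the same fibres, not
    merely isomorphic ones.\<close>
  have "ty_sub (yoneda W) (yoneda_sub \<Delta> W \<delta>) (ty_sub \<Delta> \<sigma> A) =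
      ty_sub (yoneda W) (yoneda_sub \<Gamma> W (\<sigma> W \<delta>)) A"
    using assms res_in[OF assms(1), of \<delta>] sub_res[OF assms(2), of \<delta>]
    by (intro ty_eqI) (auto simp: fib_ty_sub fres_ty_sub yoneda_sub_def el_yoneda, metis+)
  then show ?thesis by (simp add: yoneda_ext_def)
qed

text \<open>The equation is strict because the functions on both sides live over the same context,
  by \<open>yoneda_ext_ty_sub\<close>, and take values in the same type over it, by
  \<open>yl\<close>.\<close>

lemma ty_sub_Pi_ty:
  assumes "is_psh \<Delta>" "is_psh \<Gamma>" "is_sub \<Delta> \<Gamma> \<sigma>"
  shows "ty_sub \<Delta> \<sigma> (Pi_ty \<Gamma> A B) =
    Pi_ty \<Delta> (ty_sub \<Delta> \<sigma> A) (ty_sub (ctx_ext \<Delta> (ty_sub \<Delta> \<sigma> A)) (sub_lift \<Delta> \<sigma> A) B)"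
    (is "_ = Pi_ty \<Delta> ?A ?B")
proof -
  have yl: "ty_sub (yoneda_ext \<Gamma> A W (\<sigma> W \<delta>)) (yoneda_lift \<Delta> ?A W \<delta>) ?B =
      ty_sub (yoneda_ext \<Gamma> A W (\<sigma> W \<delta>)) (yoneda_lift \<Gamma> A W (\<sigma> W \<delta>)) B"
    if d: "\<delta> \<in> el \<Delta> W" for W \<delta>
  proof -
    note Y = yoneda_ext_ty_sub[OF assms(1,3) d, of A, symmetric]
    have l: "yoneda_lift \<Delta> ?A W \<delta> V (\<phi>, a) = (res \<Delta> \<phi> \<delta>, a)"
      "yoneda_lift \<Gamma> A W (\<sigma> W \<delta>) V (\<phi>, a) = (\<sigma> V (res \<Delta> \<phi> \<delta>), a)"
      "res \<Delta> \<phi> \<delta> \<in> el \<Delta> V" "a \<in> fib A V (\<sigma> V (res \<Delta> \<phi> \<delta>))"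
      if x: "(\<phi>, a) \<in> el (yoneda_ext \<Gamma> A W (\<sigma> W \<delta>)) V" for V \<phi> a
      using x sub_res[OF assms(3), of \<delta> \<phi>] res_in[OF assms(1), of \<delta> \<phi>] d
        yoneda_lift_apply[of \<phi> a \<Delta> ?A W \<delta> V]
      by (auto simp: Y[symmetric] yoneda_ext_ty_sub[OF assms(1,3) d] yoneda_lift_apply[OF x]
          el_yoneda_ext)
    show ?thesis
      by (rule ty_eqI)
         (auto simp: fib_ty_sub fres_ty_sub split_paired_all l sub_lift_apply el_ctx_ext)
  qed
  have F: "fib (Pi_ty \<Delta> ?A ?B) W \<delta> = (if \<delta> \<in> el \<Delta> W then fib (Pi_ty \<Gamma> A B) W (\<sigma> W \<delta>) else {})"
    for W \<delta>
    using yl[of \<delta> W] sub_in[OF assms(3), of \<delta> W] yoneda_ext_ty_sub[OF assms(1,3), of \<delta> W A]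
    by (auto simp: fib_Pi_ty)
  show ?thesis
  proof (rule ty_eqI)
    fix W \<delta> show "fib (ty_sub \<Delta> \<sigma> (Pi_ty \<Gamma> A B)) W \<delta> = fib (Pi_ty \<Delta> ?A ?B) W \<delta>"
      by (simp add: F fib_ty_sub)
  next
    fix \<phi> \<delta> f
    show "fres (ty_sub \<Delta> \<sigma> (Pi_ty \<Gamma> A B)) \<phi> \<delta> f = fres (Pi_ty \<Delta> ?A ?B) \<phi> \<delta> f"
    proof (cases "f \<in> fib (Pi_ty \<Delta> ?A ?B) (face_cod \<phi>) \<delta>")
      case False
      then show ?thesis by (auto simp: fres_Pi_ty_undefined fres_ty_sub F)
    next
      case True
      then have d: "\<delta> \<in> el \<Delta> (face_cod \<phi>)"
        and f: "f \<in> fib (Pi_ty \<Gamma> A B) (face_cod \<phi>) (\<sigma> (face_cod \<phi>) \<delta>)"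
        by (auto simp: F split: if_splits)
      \<comment> \<open>Both restrictions evaluate \<open>f\<close> at the composite with \<phi>.
        Their guards differ only in how the base point is written, and naturality of \<sigma>
        reconciles them.\<close>
      have "fres (Pi_ty \<Gamma> A B) \<phi> (\<sigma> (face_cod \<phi>) \<delta>) f V (\<psi>, a) =
          fres (Pi_ty \<Delta> ?A ?B) \<phi> \<delta> f V (\<psi>, a)" for V \<psi> a
        using sub_res[OF assms(3) d] sub_res[OF assms(3), of "res \<Delta> \<phi> \<delta>" \<psi>]
          res_in[OF assms(1) d] res_in[OF assms(1), of "res \<Delta> \<phi> \<delta>" \<psi>]
        by (auto simp: fres_Pi_ty[OF assms(2) f] fres_Pi_ty[OF assms(1) True] fib_ty_sub)
      then show ?thesis by (intro ext) (simp add: split_paired_all fres_ty_sub d)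
    qed
  qed
qed

lemma tm_sub_lam_tm:
  assumes "is_psh \<Delta>" "is_sub \<Delta> \<Gamma> \<sigma>"
  shows "tm_sub \<Delta> \<sigma> (lam_tm \<Gamma> A b) =
    lam_tm \<Delta> (ty_sub \<Delta> \<sigma> A) (tm_sub (ctx_ext \<Delta> (ty_sub \<Delta> \<sigma> A)) (sub_lift \<Delta> \<sigma> A) b)"
    (is "_ = lam_tm \<Delta> ?A ?b")
proof (intro ext)
  fix W \<delta> V and x :: "face \<times> 'c"
  obtain \<phi> a where x: "x = (\<phi>, a)" by fastforce
  show "tm_sub \<Delta> \<sigma> (lam_tm \<Gamma> A b) W \<delta> V x = lam_tm \<Delta> ?A ?b W \<delta> V x"
  proof (cases "\<delta> \<in> el \<Delta> W")
    case True
    then show ?thesis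
      using sub_res[OF assms(2), of \<delta> \<phi>] res_in[OF assms(1), of \<delta> \<phi>]
      by (auto simp: x tm_sub_def lam_tm_apply sub_in[OF assms(2)] fib_ty_sub el_ctx_ext sub_lift_apply)
  qed (simp add: tm_sub_def lam_tm_def)
qed

lemma tm_sub_ap_tm:
  assumes "is_sub \<Delta> \<Gamma> \<sigma>"
  shows "tm_sub (ctx_ext \<Delta> (ty_sub \<Delta> \<sigma> A)) (sub_lift \<Delta> \<sigma> A) (ap_tm \<Gamma> A f) =
    ap_tm \<Delta> (ty_sub \<Delta> \<sigma> A) (tm_sub \<Delta> \<sigma> f)"
  by (intro ext)
     (auto simp: split_paired_all tm_sub_def ap_tm_def el_ctx_ext fib_ty_sub sub_lift_apply
        sub_in[OF assms])

theorem theorem4p8: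
  shows
  "\<comment> \<open>contexts and substitutions form a category with a terminal object\<close>
   (\<forall>\<Gamma> :: 'g psh. is_psh \<Gamma> \<longrightarrow> is_sub \<Gamma> \<Gamma> (sub_id \<Gamma>)) \<and>
   (\<forall>(\<Theta> :: 'e psh) (\<Delta> :: 'd psh) (\<Gamma> :: 'g psh) \<sigma> \<tau>.
      is_psh \<Theta> \<and> is_psh \<Delta> \<and> is_psh \<Gamma> \<and> is_sub \<Delta> \<Gamma> \<sigma> \<and> is_sub \<Theta> \<Delta> \<tau> \<longrightarrow>
        is_sub \<Theta> \<Gamma> (sub_comp \<Theta> \<sigma> \<tau>)) \<and>
   (\<forall>(\<Delta> :: 'd psh) (\<Gamma> :: 'g psh) \<sigma>.
      is_psh \<Delta> \<and> is_psh \<Gamma> \<and> is_sub \<Delta> \<Gamma> \<sigma> \<longrightarrow>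
        sub_comp \<Delta> (sub_id \<Gamma>) \<sigma> = \<sigma> \<and> sub_comp \<Delta> \<sigma> (sub_id \<Delta>) = \<sigma>) \<and>
   (\<forall>(\<Xi> :: 'f psh) (\<Theta> :: 'e psh) (\<Delta> :: 'd psh) (\<Gamma> :: 'g psh) \<sigma> \<tau> \<upsilon>.
      is_psh \<Xi> \<and> is_psh \<Theta> \<and> is_psh \<Delta> \<and> is_psh \<Gamma> \<and>
      is_sub \<Delta> \<Gamma> \<sigma> \<and> is_sub \<Theta> \<Delta> \<tau> \<and> is_sub \<Xi> \<Theta> \<upsilon> \<longrightarrow>
        sub_comp \<Xi> (sub_comp \<Theta> \<sigma> \<tau>) \<upsilon> = sub_comp \<Xi> \<sigma> (sub_comp \<Xi> \<tau> \<upsilon>)) \<and>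
   is_psh empty_ctx \<and>
   (\<forall>\<Gamma> :: 'g psh. is_psh \<Gamma> \<longrightarrow> (\<exists>!\<sigma>. is_sub \<Gamma> empty_ctx \<sigma>)) \<and>

   \<comment> \<open>discrete types and their terms: functorial action of substitutions\<close>
   (\<forall>(\<Delta> :: 'd psh) (\<Gamma> :: 'g psh) \<sigma> (T :: ('g, 'a) ty).
      is_psh \<Delta> \<and> is_psh \<Gamma> \<and> is_sub \<Delta> \<Gamma> \<sigma> \<and> disc_ty \<Gamma> T \<longrightarrow>
        disc_ty \<Delta> (ty_sub \<Delta> \<sigma> T) \<and>
        (\<forall>t. is_tm \<Gamma> T t \<longrightarrow> is_tm \<Delta> (ty_sub \<Delta> \<sigma> T) (tm_sub \<Delta> \<sigma> t))) \<and>
   (\<forall>(\<Gamma> :: 'g psh) (T :: ('g, 'a) ty).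
      is_psh \<Gamma> \<and> disc_ty \<Gamma> T \<longrightarrow>
        ty_sub \<Gamma> (sub_id \<Gamma>) T = T \<and>
        (\<forall>t. is_tm \<Gamma> T t \<longrightarrow> tm_sub \<Gamma> (sub_id \<Gamma>) t = t)) \<and>
   (\<forall>(\<Theta> :: 'e psh) (\<Delta> :: 'd psh) (\<Gamma> :: 'g psh) \<sigma> \<tau> (T :: ('g, 'a) ty).
      is_psh \<Theta> \<and> is_psh \<Delta> \<and> is_psh \<Gamma> \<and> is_sub \<Delta> \<Gamma> \<sigma> \<and> is_sub \<Theta> \<Delta> \<tau> \<and> disc_ty \<Gamma> T \<longrightarrow>
        ty_sub \<Theta> (sub_comp \<Theta> \<sigma> \<tau>) T = ty_sub \<Theta> \<tau> (ty_sub \<Delta> \<sigma> T) \<and>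
        (\<forall>t. is_tm \<Gamma> T t \<longrightarrow>
           tm_sub \<Theta> (sub_comp \<Theta> \<sigma> \<tau>) t = tm_sub \<Theta> \<tau> (tm_sub \<Delta> \<sigma> t))) \<and>

   \<comment> \<open>context extension by a discrete type\<close>
   (\<forall>(\<Gamma> :: 'g psh) (T :: ('g, 'a) ty).
      is_psh \<Gamma> \<and> disc_ty \<Gamma> T \<longrightarrow>
        is_psh (ctx_ext \<Gamma> T) \<and>
        is_sub (ctx_ext \<Gamma> T) \<Gamma> (proj \<Gamma> T) \<and>
        is_tm (ctx_ext \<Gamma> T) (ty_sub (ctx_ext \<Gamma> T) (proj \<Gamma> T) T) (last_var \<Gamma> T)) \<and>
   (\<forall>(\<Delta> :: 'd psh) (\<Gamma> :: 'g psh) \<sigma> (T :: ('g, 'a) ty) t.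
      is_psh \<Delta> \<and> is_psh \<Gamma> \<and> disc_ty \<Gamma> T \<and> is_sub \<Delta> \<Gamma> \<sigma> \<and> is_tm \<Delta> (ty_sub \<Delta> \<sigma> T) t \<longrightarrow>
        is_sub \<Delta> (ctx_ext \<Gamma> T) (sub_ext \<Delta> \<sigma> t) \<and>
        sub_comp \<Delta> (proj \<Gamma> T) (sub_ext \<Delta> \<sigma> t) = \<sigma> \<and>
        tm_sub \<Delta> (sub_ext \<Delta> \<sigma> t) (last_var \<Gamma> T) = t \<and>
        (\<forall>\<rho>. is_sub \<Delta> (ctx_ext \<Gamma> T) \<rho> \<and> sub_comp \<Delta> (proj \<Gamma> T) \<rho> = \<sigma> \<and>
             tm_sub \<Delta> \<rho> (last_var \<Gamma> T) = t \<longrightarrow> \<rho> = sub_ext \<Delta> \<sigma> t)) \<and>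

   \<comment> \<open>dependent products\<close>
   (\<forall>(\<Gamma> :: 'g psh) (A :: ('g, 'a) ty) (B :: ('g \<times> 'a, 'b) ty).
      is_psh \<Gamma> \<and> disc_ty \<Gamma> A \<and> disc_ty (ctx_ext \<Gamma> A) B \<longrightarrow>
        disc_ty \<Gamma> (Pi_ty \<Gamma> A B) \<and>
        (\<forall>b. is_tm (ctx_ext \<Gamma> A) B b \<longrightarrow>
           is_tm \<Gamma> (Pi_ty \<Gamma> A B) (lam_tm \<Gamma> A b) \<and> ap_tm \<Gamma> A (lam_tm \<Gamma> A b) = b) \<and>
        (\<forall>f. is_tm \<Gamma> (Pi_ty \<Gamma> A B) f \<longrightarrow>
           is_tm (ctx_ext \<Gamma> A) B (ap_tm \<Gamma> A f) \<and> lam_tm \<Gamma> A (ap_tm \<Gamma> A f) = f)) \<and>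
   (\<forall>(\<Delta> :: 'd psh) (\<Gamma> :: 'g psh) \<sigma> (A :: ('g, 'a) ty) (B :: ('g \<times> 'a, 'b) ty).
      is_psh \<Delta> \<and> is_psh \<Gamma> \<and> is_sub \<Delta> \<Gamma> \<sigma> \<and> disc_ty \<Gamma> A \<and> disc_ty (ctx_ext \<Gamma> A) B \<longrightarrow>
        ty_sub \<Delta> \<sigma> (Pi_ty \<Gamma> A B) =
          Pi_ty \<Delta> (ty_sub \<Delta> \<sigma> A)
            (ty_sub (ctx_ext \<Delta> (ty_sub \<Delta> \<sigma> A)) (sub_lift \<Delta> \<sigma> A) B) \<and>
        (\<forall>b. is_tm (ctx_ext \<Gamma> A) B b \<longrightarrow>
           tm_sub \<Delta> \<sigma> (lam_tm \<Gamma> A b) =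
             lam_tm \<Delta> (ty_sub \<Delta> \<sigma> A)
               (tm_sub (ctx_ext \<Delta> (ty_sub \<Delta> \<sigma> A)) (sub_lift \<Delta> \<sigma> A) b)) \<and>
        (\<forall>f. is_tm \<Gamma> (Pi_ty \<Gamma> A B) f \<longrightarrow>
           tm_sub (ctx_ext \<Delta> (ty_sub \<Delta> \<sigma> A)) (sub_lift \<Delta> \<sigma> A) (ap_tm \<Gamma> A f) =
             ap_tm \<Delta> (ty_sub \<Delta> \<sigma> A) (tm_sub \<Delta> \<sigma> f))) \<and>

   \<comment> \<open>dependent sums\<close>
   (\<forall>(\<Gamma> :: 'g psh) (A :: ('g, 'a) ty) (B :: ('g \<times> 'a, 'b) ty).
      is_psh \<Gamma> \<and> disc_ty \<Gamma> A \<and> disc_ty (ctx_ext \<Gamma> A) B \<longrightarrow>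
        disc_ty \<Gamma> (Sigma_ty \<Gamma> A B) \<and>
        (\<forall>a b. is_tm \<Gamma> A a \<and> is_tm \<Gamma> (ty_sub \<Gamma> (sub_inst \<Gamma> a) B) b \<longrightarrow>
           is_tm \<Gamma> (Sigma_ty \<Gamma> A B) (pair_tm \<Gamma> a b) \<and>
           fst_tm \<Gamma> (pair_tm \<Gamma> a b) = a \<and> snd_tm \<Gamma> (pair_tm \<Gamma> a b) = b) \<and>
        (\<forall>p. is_tm \<Gamma> (Sigma_ty \<Gamma> A B) p \<longrightarrow>
           is_tm \<Gamma> A (fst_tm \<Gamma> p) \<and>
           is_tm \<Gamma> (ty_sub \<Gamma> (sub_inst \<Gamma> (fst_tm \<Gamma> p)) B) (snd_tm \<Gamma> p) \<and>
           pair_tm \<Gamma> (fst_tm \<Gamma> p) (snd_tm \<Gamma> p) = p)) \<and>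
   (\<forall>(\<Delta> :: 'd psh) (\<Gamma> :: 'g psh) \<sigma> (A :: ('g, 'a) ty) (B :: ('g \<times> 'a, 'b) ty).
      is_psh \<Delta> \<and> is_psh \<Gamma> \<and> is_sub \<Delta> \<Gamma> \<sigma> \<and> disc_ty \<Gamma> A \<and> disc_ty (ctx_ext \<Gamma> A) B \<longrightarrow>
        ty_sub \<Delta> \<sigma> (Sigma_ty \<Gamma> A B) =
          Sigma_ty \<Delta> (ty_sub \<Delta> \<sigma> A)
            (ty_sub (ctx_ext \<Delta> (ty_sub \<Delta> \<sigma> A)) (sub_lift \<Delta> \<sigma> A) B) \<and>
        (\<forall>a b. is_tm \<Gamma> A a \<and> is_tm \<Gamma> (ty_sub \<Gamma> (sub_inst \<Gamma> a) B) b \<longrightarrow>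
           tm_sub \<Delta> \<sigma> (pair_tm \<Gamma> a b) = pair_tm \<Delta> (tm_sub \<Delta> \<sigma> a) (tm_sub \<Delta> \<sigma> b)) \<and>
        (\<forall>p. is_tm \<Gamma> (Sigma_ty \<Gamma> A B) p \<longrightarrow>
           tm_sub \<Delta> \<sigma> (fst_tm \<Gamma> p) = fst_tm \<Delta> (tm_sub \<Delta> \<sigma> p) \<and>
           tm_sub \<Delta> \<sigma> (snd_tm \<Gamma> p) = snd_tm \<Delta> (tm_sub \<Delta> \<sigma> p))) \<and>

   \<comment> \<open>identity types\<close>
   (\<forall>(\<Gamma> :: 'g psh) (A :: ('g, 'a) ty) a.
      is_psh \<Gamma> \<and> disc_ty \<Gamma> A \<and> is_tm \<Gamma> A a \<longrightarrow>
        (\<forall>b. is_tm \<Gamma> A b \<longrightarrow> disc_ty \<Gamma> (Id_ty \<Gamma> A a b)) \<and>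
        is_tm \<Gamma> (Id_ty \<Gamma> A a a) (refl_tm \<Gamma> a)) \<and>
   (\<forall>(\<Gamma> :: 'g psh) (A :: ('g, 'a) ty) a b (C :: (('g \<times> 'a) \<times> unit, 'c) ty) e c.
      is_psh \<Gamma> \<and> disc_ty \<Gamma> A \<and> is_tm \<Gamma> A a \<and> is_tm \<Gamma> A b \<and>
      disc_ty (Id_motive_ctx \<Gamma> A a) C \<and> is_tm \<Gamma> (Id_ty \<Gamma> A a b) e \<and>
      is_tm \<Gamma> (ty_sub \<Gamma> (Id_inst \<Gamma> a (refl_tm \<Gamma> a)) C) c \<longrightarrow>
        is_tm \<Gamma> (ty_sub \<Gamma> (Id_inst \<Gamma> b e) C) (J_tm a b C e c)) \<and>
   (\<forall>(\<Gamma> :: 'g psh) (A :: ('g, 'a) ty) a (C :: (('g \<times> 'a) \<times> unit, 'c) ty) c.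
      is_psh \<Gamma> \<and> disc_ty \<Gamma> A \<and> is_tm \<Gamma> A a \<and> disc_ty (Id_motive_ctx \<Gamma> A a) C \<and>
      is_tm \<Gamma> (ty_sub \<Gamma> (Id_inst \<Gamma> a (refl_tm \<Gamma> a)) C) c \<longrightarrow>
        J_tm a a C (refl_tm \<Gamma> a) c = c) \<and>
   (\<forall>(\<Delta> :: 'd psh) (\<Gamma> :: 'g psh) \<sigma> (A :: ('g, 'a) ty) a b.
      is_psh \<Delta> \<and> is_psh \<Gamma> \<and> is_sub \<Delta> \<Gamma> \<sigma> \<and> disc_ty \<Gamma> A \<and> is_tm \<Gamma> A a \<and> is_tm \<Gamma> A b \<longrightarrow>
        ty_sub \<Delta> \<sigma> (Id_ty \<Gamma> A a b) =
          Id_ty \<Delta> (ty_sub \<Delta> \<sigma> A) (tm_sub \<Delta> \<sigma> a) (tm_sub \<Delta> \<sigma> b) \<and>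
        tm_sub \<Delta> \<sigma> (refl_tm \<Gamma> a) = refl_tm \<Delta> (tm_sub \<Delta> \<sigma> a)) \<and>
   (\<forall>(\<Delta> :: 'd psh) (\<Gamma> :: 'g psh) \<sigma> (A :: ('g, 'a) ty) a b
       (C :: (('g \<times> 'a) \<times> unit, 'c) ty) e c.
      is_psh \<Delta> \<and> is_psh \<Gamma> \<and> is_sub \<Delta> \<Gamma> \<sigma> \<and> disc_ty \<Gamma> A \<and> is_tm \<Gamma> A a \<and> is_tm \<Gamma> A b \<and>
      disc_ty (Id_motive_ctx \<Gamma> A a) C \<and> is_tm \<Gamma> (Id_ty \<Gamma> A a b) e \<and>
      is_tm \<Gamma> (ty_sub \<Gamma> (Id_inst \<Gamma> a (refl_tm \<Gamma> a)) C) c \<longrightarrow>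
        tm_sub \<Delta> \<sigma> (J_tm a b C e c) =
          J_tm (tm_sub \<Delta> \<sigma> a) (tm_sub \<Delta> \<sigma> b)
            (ty_sub (Id_motive_ctx \<Delta> (ty_sub \<Delta> \<sigma> A) (tm_sub \<Delta> \<sigma> a))
               (sub_lift (ctx_ext \<Delta> (ty_sub \<Delta> \<sigma> A)) (sub_lift \<Delta> \<sigma> A) (Id_motive_ty \<Gamma> A a)) C)
            (tm_sub \<Delta> \<sigma> e) (tm_sub \<Delta> \<sigma> c))"
  \<comment> \<open>Once discrete types are split into being types and being discrete, the conjuncts
    are instances of the lemmas above. The equations for \<open>J_tm\<close> hold by unfolding,
    since it returns its last argument.\<close>
  unfolding disc_ty_def
  by (intro conjI allI impI; (elim conjE)?;
      (assumption | rule is_sub_id is_sub_comp sub_comp_id sub_comp_assoc is_psh_empty_ctx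
        ex1_sub_empty_ctx is_ty_ty_sub is_tm_tm_sub discrete_ty_sub ty_sub_id tm_sub_id ty_sub_comp
        tm_sub_comp is_psh_ctx_ext is_sub_proj is_tm_last_var is_sub_sub_ext proj_sub_ext
        last_var_sub_ext sub_ext_unique is_ty_Pi_ty discrete_Pi_ty is_tm_lam_tm ap_lam_tm
        is_tm_ap_tm lam_ap_tm ty_sub_Pi_ty tm_sub_lam_tm tm_sub_ap_tm is_ty_Sigma_ty
        discrete_Sigma_ty is_tm_pair_tm fst_pair_tm snd_pair_tm is_tm_fst_tm is_tm_snd_tm
        pair_fst_snd_tm ty_sub_Sigma_ty tm_sub_pair_tm tm_sub_fst_tm tm_sub_snd_tm is_ty_Id_ty
        discrete_Id_ty is_tm_refl_tm is_tm_J_tm ty_sub_Id_ty tm_sub_refl_tm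
      | simp add: J_tm_def)+)

end
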